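(* Let $(X,R)$ be an Adian presentation, where $X$ is a non-empty set and $R=\{(u_i,v_i): i\in I\}$ with $u_i,v_i\in X^+$. Then the inverse semigroup $S=\mathrm{Inv}\langle X\mid R\rangle$ is $E$-unitary.
   Context: $X^+$ is the set of non-empty words over $X$. A positive presentation is a pair $P=(X,R)$ with $X$ a non-empty set and $R=\{(u_i,v_i):i\in I\}$, $u_i,v_i\in X^+$. Its left graph $LG(P)$ is the undirected (multi)graph with vertex set $X$ and, for each relation $(u_i,v_i)\in R$, one edge joining the first letter of $u_i$ to the first letter of $v_i$. Its right graph $RG(P)$ is defined in the same way using last letters. (There is one edge per relation; loops and pairs of parallel edges count as cycles.) $P$ is an Adian presentation (also called cycle-free) if neither $LG(P)$ nor $RG(P)$ contains a cycle. An inverse semigroup is a semigroup $S$ in which every $a$ has a unique $b=a^{-1}$ with $aba=a$ and $bab=b$. $\mathrm{Inv}\langle X\mid R\rangle$ is the quotient of the free inverse semigroup on $X$ by the congruence generated by the relations $u_i=v_i$ ($i\in I$). The natural partial order on $S$ is $a\le b$ iff $a=aa^{-1}b$. The minimum group congruence $\sigma$ on $S$ is given by $a\,\sigma\, b$ iff there is $c\in S$ with $c\le a$ and $c\le b$; $S/\sigma$ is the maximum group homomorphic image of $S$. $S$ is $E$-unitary if the natural homomorphism $S\to S/\sigma$ is idempotent-pure, i.e. the preimage of the identity of $S/\sigma$ is exactly the set of idempotents of $S$. *)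

theory Defs
  imports "HOL-Algebra.Congruence"
begin

section \<open>Semigroups, congruences and quotients\<close>

text \<open>The record of HOL-Algebra for monoids has a field for the unit, which semigroups lack.\<close>

record 'a magma = "'a partial_object" +
  sop :: "['a, 'a] \<Rightarrow> 'a" (infixl "\<star>\<index>" 70)

definition congruence_on :: "('a, 'b) magma_scheme \<Rightarrow> ('a \<times> 'a) set \<Rightarrow> bool" where
  "congruence_on S r \<longleftrightarrow> equiv (carrier S) r \<and>
     (\<forall>(a, b) \<in> r. \<forall>c \<in> carrier S. (c \<star>\<^bsub>S\<^esub> a, c \<star>\<^bsub>S\<^esub> b) \<in> r \<and> (a \<star>\<^bsub>S\<^esub> c, b \<star>\<^bsub>S\<^esub> c) \<in> r)"

definition congruence_generated :: "('a, 'b) magma_scheme \<Rightarrow> ('a \<times> 'a) set \<Rightarrow> ('a \<times> 'a) set" where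
  "congruence_generated S R = \<Inter>{r. congruence_on S r \<and> R \<subseteq> r}"

text \<open>If \<open>r\<close> is a congruence, the union below is the class of \<open>a \<star> b\<close> for any
  representatives \<open>a\<close> of \<open>A\<close> and \<open>b\<close> of \<open>B\<close>.\<close>

definition quotient_magma :: "('a, 'b) magma_scheme \<Rightarrow> ('a \<times> 'a) set \<Rightarrow> 'a set magma" where
  "quotient_magma S r =
     \<lparr>carrier = carrier S // r, sop = (\<lambda>A B. \<Union>a\<in>A. \<Union>b\<in>B. r `` {a \<star>\<^bsub>S\<^esub> b})\<rparr>"

definition idempotents :: "('a, 'b) magma_scheme \<Rightarrow> 'a set" where
  "idempotents S = {a \<in> carrier S. a \<star>\<^bsub>S\<^esub> a = a}"

definition is_identity :: "('a, 'b) magma_scheme \<Rightarrow> 'a \<Rightarrow> bool" where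
  "is_identity S e \<longleftrightarrow> e \<in> carrier S \<and>
     (\<forall>a \<in> carrier S. e \<star>\<^bsub>S\<^esub> a = a \<and> a \<star>\<^bsub>S\<^esub> e = a)"


section \<open>Inverse semigroups and E-unitarity\<close>

locale inverse_semigroup =
  fixes S (structure)
  assumes closed: "\<lbrakk>a \<in> carrier S; b \<in> carrier S\<rbrakk> \<Longrightarrow> a \<star> b \<in> carrier S"
    and assoc: "\<lbrakk>a \<in> carrier S; b \<in> carrier S; c \<in> carrier S\<rbrakk> \<Longrightarrow> (a \<star> b) \<star> c = a \<star> (b \<star> c)"
    and unique_inverse:
      "a \<in> carrier S \<Longrightarrow> \<exists>!b. b \<in> carrier S \<and> a \<star> b \<star> a = a \<and> b \<star> a \<star> b = b"

definition sinv :: "('a, 'b) magma_scheme \<Rightarrow> 'a \<Rightarrow> 'a" where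
  "sinv S a = (THE b. b \<in> carrier S \<and> a \<star>\<^bsub>S\<^esub> b \<star>\<^bsub>S\<^esub> a = a \<and> b \<star>\<^bsub>S\<^esub> a \<star>\<^bsub>S\<^esub> b = b)"

definition natural_le :: "('a, 'b) magma_scheme \<Rightarrow> 'a \<Rightarrow> 'a \<Rightarrow> bool" where
  "natural_le S a b \<longleftrightarrow> a = a \<star>\<^bsub>S\<^esub> sinv S a \<star>\<^bsub>S\<^esub> b"

definition min_group_congruence :: "('a, 'b) magma_scheme \<Rightarrow> ('a \<times> 'a) set" where
  "min_group_congruence S = {(a, b). a \<in> carrier S \<and> b \<in> carrier S \<and>
     (\<exists>c \<in> carrier S. natural_le S c a \<and> natural_le S c b)}"

definition max_group_image :: "('a, 'b) magma_scheme \<Rightarrow> 'a set magma" where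
  "max_group_image S = quotient_magma S (min_group_congruence S)"

text \<open>An identity of a magma is unique, so \<open>e\<close> is the identity of the maximum group image;
  the natural homomorphism sends \<open>a\<close> to its class.\<close>

definition E_unitary :: "('a, 'b) magma_scheme \<Rightarrow> bool" where
  "E_unitary S \<longleftrightarrow> inverse_semigroup S \<and>
     (\<exists>e. is_identity (max_group_image S) e \<and>
          {a \<in> carrier S. min_group_congruence S `` {a} = e} = idempotents S)"


section \<open>Free inverse semigroups and presentations\<close>

definition word_semigroup :: "'a set \<Rightarrow> 'a list magma" where
  "word_semigroup X = \<lparr>carrier = {w. w \<noteq> [] \<and> set w \<subseteq> X}, sop = (@)\<rparr>"

datatype 'a letter = Pos 'a | Neg 'a

fun inv_letter :: "'a letter \<Rightarrow> 'a letter" where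
  "inv_letter (Pos x) = Neg x"
| "inv_letter (Neg x) = Pos x"

definition inv_word :: "'a letter list \<Rightarrow> 'a letter list" where
  "inv_word w = rev (map inv_letter w)"

definition signed_words :: "'a set \<Rightarrow> 'a letter list magma" where
  "signed_words X = word_semigroup (Pos ` X \<union> Neg ` X)"

text \<open>The free inverse semigroup is realised as the quotient of the free semigroup on
  \<open>X \<union> X\<inverse>\<close> by the Vagner congruence.\<close>

definition vagner :: "'a set \<Rightarrow> ('a letter list \<times> 'a letter list) set" where
  "vagner X = congruence_generated (signed_words X)
     ({(u @ inv_word u @ u, u) | u. u \<in> carrier (signed_words X)} \<union>
      {(u @ inv_word u @ v @ inv_word v, v @ inv_word v @ u @ inv_word u) | u v.
         u \<in> carrier (signed_words X) \<and> v \<in> carrier (signed_words X)})"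

definition free_inverse_semigroup :: "'a set \<Rightarrow> 'a letter list set magma" where
  "free_inverse_semigroup X = quotient_magma (signed_words X) (vagner X)"

definition positive_element :: "'a set \<Rightarrow> 'a list \<Rightarrow> 'a letter list set" where
  "positive_element X u = vagner X `` {map Pos u}"

definition Inv :: "'a set \<Rightarrow> ('a list \<times> 'a list) set \<Rightarrow> 'a letter list set set magma" where
  "Inv X R = quotient_magma (free_inverse_semigroup X)
     (congruence_generated (free_inverse_semigroup X)
        {(positive_element X u, positive_element X v) | u v. (u, v) \<in> R})"

definition positive_presentation :: "'a set \<Rightarrow> ('a list \<times> 'a list) set \<Rightarrow> bool" where
  "positive_presentation X R \<longleftrightarrow> X \<noteq> {} \<and>
     R \<subseteq> carrier (word_semigroup X) \<times> carrier (word_semigroup X)"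


section \<open>Left and right graphs\<close>

text \<open>Undirected multigraphs: \<open>ends e\<close> is the set of end points of \<open>e\<close>, a singleton if
  \<open>e\<close> is a loop.\<close>

record ('v, 'e) multigraph =
  verts :: "'v set"
  edges :: "'e set"
  ends :: "'e \<Rightarrow> 'v set"

text \<open>A cycle visits \<open>vs ! 0, vs ! 1, \<dots>\<close> and closes up; length one is a loop, and length two
  is a pair of distinct parallel edges.\<close>

definition is_cycle :: "('v, 'e) multigraph \<Rightarrow> 'v list \<Rightarrow> 'e list \<Rightarrow> bool" where
  "is_cycle G vs es \<longleftrightarrow> es \<noteq> [] \<and> length vs = length es \<and> distinct vs \<and> distinct es \<and>
     set vs \<subseteq> verts G \<and> set es \<subseteq> edges G \<and>
     (\<forall>i < length es. ends G (es ! i) = {vs ! i, vs ! (Suc i mod length es)})"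

definition acyclic_multigraph :: "('v, 'e) multigraph \<Rightarrow> bool" where
  "acyclic_multigraph G \<longleftrightarrow> (\<nexists>vs es. is_cycle G vs es)"

definition left_graph ::
    "'a set \<Rightarrow> ('a list \<times> 'a list) set \<Rightarrow> ('a, 'a list \<times> 'a list) multigraph" where
  "left_graph X R = \<lparr>verts = X, edges = R, ends = (\<lambda>(u, v). {hd u, hd v})\<rparr>"

definition right_graph ::
    "'a set \<Rightarrow> ('a list \<times> 'a list) set \<Rightarrow> ('a, 'a list \<times> 'a list) multigraph" where
  "right_graph X R = \<lparr>verts = X, edges = R, ends = (\<lambda>(u, v). {last u, last v})\<rparr>"

definition adian_presentation :: "'a set \<Rightarrow> ('a list \<times> 'a list) set \<Rightarrow> bool" where
  "adian_presentation X R \<longleftrightarrow> positive_presentation X R \<and>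
     acyclic_multigraph (left_graph X R) \<and> acyclic_multigraph (right_graph X R)"

end

theory Submission
  imports Defs
begin

text \<open>
  Any inverse semigroup acts on itself by partial injections (Vagner-Preston). For
  \<open>S = Inv\<langle>X | R\<rangle>\<close> this gives one partial injection per letter, such that \<open>u\<close> and \<open>v\<close> act as
  the same partial injection for every relation \<open>(u, v)\<close>. The point is that such a partial action
  embeds into one in which all letters and their inverses act everywhere on the image, so that,
  iterating, all words up to any given length do. A word \<open>w\<close> that is trivial in the group then
  returns to every point where it acts; applied to \<open>w w\<inverse>\<close>, which \<open>w\<close> moves to \<open>w\<close>, this gives
  \<open>w = w w\<inverse>\<close>, an idempotent.

  To make the positive letters total, adjoin formal points \<open>(\<gamma>, w)\<close> with \<open>w\<close> a positive word, modulo
  \<open>(\<gamma>, x w) = (\<gamma> x, w)\<close> and the relations. No old points are identified, because \<open>u\<close> and \<open>v\<close> have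
  equal domains. Appending a letter stays injective by Adian's argument: the last letters
  along a derivation between \<open>(\<gamma>, w x)\<close> and \<open>(\<gamma>', w' x)\<close> form a closed walk in the right graph, which is
  a forest, so the walk backtracks and the derivation can be shortened. The inverse letters
  are made total in the same way, with the left graph.
\<close>

section \<open>Closed walks in the right graph\<close>

text \<open>A shortest closed subwalk repeats no vertex. If no edge is followed by itself, it
  repeats no edge either and is a cycle.\<close>

lemma acyclic_closed_walk_backtracks:
  fixes f :: "nat \<Rightarrow> 'v" and g :: "nat \<Rightarrow> 'e"
  assumes acyclic: "acyclic_multigraph G" and "0 < n" and closed: "f n = f 0"
    and verts: "\<And>i. i < n \<Longrightarrow> f i \<in> verts G" and edges: "\<And>i. i < n \<Longrightarrow> g i \<in> edges G"
    and ends: "\<And>i. i < n \<Longrightarrow> ends G (g i) = {f i, f (Suc i)}"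
  shows "\<exists>i. Suc i < n \<and> g i = g (Suc i)"
proof (rule ccontr)
  assume no_backtrack: "\<not> ?thesis"
  define closes where "closes d \<longleftrightarrow> 0 < d \<and> (\<exists>i. i + d \<le> n \<and> f (i + d) = f i)" for d
  have "closes n" using \<open>0 < n\<close> closed by (auto simp: closes_def intro!: exI[of _ 0])
  \<comment> \<open>The length of a shortest closed subwalk, over all starting positions.\<close>
  define d where "d = (LEAST d. closes d)"
  have "closes d" unfolding d_def by (rule LeastI) fact
  then obtain i where i: "0 < d" "i + d \<le> n" "f (i + d) = f i" by (auto simp: closes_def)
  have minimal: "k = j + d" if "j < k" "k \<le> i + d" "i \<le> j" "f j = f k" for j k
  proof (rule ccontr)
    assume "k \<noteq> j + d"
    with that have "k - j < d" by linarith
    moreover have "closes (k - j)"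
      using that i unfolding closes_def by (intro conjI exI[of _ j]) auto
    ultimately show False unfolding d_def using not_less_Least by blast
  qed
  define vs where "vs = map (\<lambda>j. f (i + j)) [0..<d]"
  define es where "es = map (\<lambda>j. g (i + j)) [0..<d]"
  have "inj_on (\<lambda>j. f (i + j)) {0..<d}"
  proof (rule linorder_inj_onI)
    fix j k assume "j < k" "j \<in> {0..<d}" "k \<in> {0..<d}"
    then show "f (i + j) \<noteq> f (i + k)" using minimal[of "i + j" "i + k"] by auto
  qed auto
  then have "distinct vs" by (simp add: vs_def distinct_map)
  moreover have "distinct es"
  proof -
    have "g (i + j) \<noteq> g (i + k)" if jk: "j < k" "k < d" for j k
    proof
      assume eq: "g (i + j) = g (i + k)"
      with ends[of "i + j"] ends[of "i + k"] jk i(2)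
      have pair: "{f (i + j), f (Suc (i + j))} = {f (i + k), f (Suc (i + k))}" by simp
      \<comment> \<open>Starting points inside the subwalk differ, so an edge used twice is crossed
        in opposite directions. The vertex after the first crossing is then the vertex before the
        second, and by minimality the crossings are consecutive.\<close>
      have "f (i + j) \<noteq> f (i + k)" using minimal[of "i + j" "i + k"] jk by auto
      with pair have "f (i + j) = f (Suc (i + k))" "f (Suc (i + j)) = f (i + k)"
        by (auto simp: doubleton_eq_iff)
      with minimal[of "i + j" "Suc (i + k)"] minimal[of "Suc (i + j)" "i + k"] jk
      have "k = Suc j" by (cases "Suc j = k") auto
      with eq no_backtrack jk i(2) show False by auto
    qed
    then have "inj_on (\<lambda>j. g (i + j)) {0..<d}" by (intro linorder_inj_onI) auto
    then show ?thesis by (simp add: es_def distinct_map)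
  qed
  moreover have "multigraph.ends G (es ! j) = {vs ! j, vs ! (Suc j mod d)}" if "j < d" for j
  proof -
    have "f (Suc (i + j)) = vs ! (Suc j mod d)"
    proof (cases "Suc j = d")
      case True
      with i(1,3) have "vs ! (Suc j mod d) = f (i + Suc j)" by (simp add: vs_def)
      then show ?thesis by simp
    next
      case False
      with that show ?thesis by (simp add: vs_def)
    qed
    with that i(2) ends[of "i + j"] show ?thesis by (simp add: vs_def es_def)
  qed
  ultimately have "is_cycle G vs es"
    using i(1,2) verts edges unfolding is_cycle_def
    by (intro conjI) (auto simp: vs_def es_def)
  with acyclic show False by (auto simp: acyclic_multigraph_def)
qed

text \<open>A walk in the right graph with directed crossings: crossing a relation backwards is
  recorded as the swapped pair, so turning back reads \<open>(u, v), (v, u)\<close>.\<close>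

fun last_walk :: "('a list \<times> 'a list) set \<Rightarrow> 'a \<Rightarrow> ('a list \<times> 'a list) list \<Rightarrow> 'a \<Rightarrow> bool" where
  "last_walk R x [] y \<longleftrightarrow> x = y"
| "last_walk R x ((u, v) # es) y \<longleftrightarrow>
     (u, v) \<in> R \<union> R\<inverse> \<and> x = last u \<and> last_walk R (last v) es y"

lemma last_walk_append:
  "last_walk R x (es @ fs) y \<longleftrightarrow> (\<exists>z. last_walk R x es z \<and> last_walk R z fs y)"
  by (induction R x es y rule: last_walk.induct) auto

lemma last_walk_nth:
  assumes "last_walk R x es y" "i < length es"
  shows "es ! i \<in> R \<union> R\<inverse>"
    and "last (snd (es ! i)) = (if Suc i < length es then last (fst (es ! Suc i)) else y)"
proof -
  have "es ! i \<in> R \<union> R\<inverse> \<and>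
    last (snd (es ! i)) = (if Suc i < length es then last (fst (es ! Suc i)) else y)"
    using assms
  proof (induction R x es y arbitrary: i rule: last_walk.induct)
    case (2 R x u v es y)
    show ?case
    proof (cases i)
      case 0
      with 2 show ?thesis by (cases es) auto
    next
      case (Suc j)
      with 2 show ?thesis by auto
    qed
  qed simp
  then show "es ! i \<in> R \<union> R\<inverse>"
    "last (snd (es ! i)) = (if Suc i < length es then last (fst (es ! Suc i)) else y)"
    by auto
qed

text \<open>The form in which acyclicity enters the rest of the proof: it concerns lists of
  relations only and can be used for \<open>R\<close> and for its reversal alike.\<close>

definition backtracking :: "('a list \<times> 'a list) set \<Rightarrow> bool" where
  "backtracking R \<longleftrightarrow> (\<forall>x es. last_walk R x es x \<longrightarrow> es \<noteq> [] \<longrightarrow>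
     (\<exists>es1 u v es2. es = es1 @ [(u, v), (v, u)] @ es2))"

lemma last_in: "w \<in> carrier (word_semigroup X) \<Longrightarrow> last w \<in> X"
  by (auto simp: word_semigroup_def)

text \<open>Some edge is crossed twice in a row. Two crossings in the same direction would make it a
  loop, so the second crossing undoes the first.\<close>

lemma acyclic_right_graph_backtracking:
  assumes pos: "positive_presentation X R" and acyclic: "acyclic_multigraph (right_graph X R)"
  shows "backtracking R"
  unfolding backtracking_def
proof (intro allI impI)
  fix x es assume walk: "last_walk R x es x" and "es \<noteq> []"
  \<comment> \<open>The last letters visited; the default \<open>x\<close> at index
    \<open>length es\<close> closes the walk.\<close>
  define f where "f i = (if i < length es then last (fst (es ! i)) else x)" for i
  \<comment> \<open>The edge under each step: a pair outside \<open>R\<close> is swapped back into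
    \<open>R\<close>.\<close>
  define g where "g i = (if es ! i \<in> R then es ! i else prod.swap (es ! i))" for i
  have f0: "f 0 = x" using walk \<open>es \<noteq> []\<close> by (cases es) (auto simp: f_def)
  have nth: "es ! i \<in> R \<union> R\<inverse>" "last (snd (es ! i)) = f (Suc i)" "last (fst (es ! i)) = f i"
    if "i < length es" for i
    using last_walk_nth[OF walk that] that by (auto simp: f_def)
  have R: "u \<in> carrier (word_semigroup X)" "v \<in> carrier (word_semigroup X)" if "(u, v) \<in> R" for u v
    using pos that by (auto simp: positive_presentation_def)
  have edges: "g i \<in> R" if "i < length es" for i
    using nth[OF that] by (cases "es ! i") (auto simp: g_def)
  have ends: "ends (right_graph X R) (g i) = {f i, f (Suc i)}" if "i < length es" for i
    using nth[OF that] by (cases "es ! i") (auto simp: g_def right_graph_def)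
  have verts: "f i \<in> X" if "i < length es" for i
  proof -
    obtain u v where "es ! i = (u, v)" by fastforce
    with nth(1,3)[OF that] have "f i = last u" "(u, v) \<in> R \<or> (v, u) \<in> R" by auto
    then show ?thesis using R last_in by metis
  qed
  have "\<exists>i. Suc i < length es \<and> g i = g (Suc i)"
    using acyclic \<open>es \<noteq> []\<close> f0 verts edges ends
    by (intro acyclic_closed_walk_backtracks[of "right_graph X R" _ f])
       (auto simp: right_graph_def f_def[of "length es"])
  then obtain i where i: "Suc i < length es" "g i = g (Suc i)" by blast
  have noloop: "f i \<noteq> f (Suc i)"
  proof
    assume "f i = f (Suc i)"
    with ends[of i] edges[of i] verts[of i] i(1)
    have "is_cycle (right_graph X R) [f i] [g i]"
      by (simp add: is_cycle_def right_graph_def)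
    with acyclic show False by (auto simp: acyclic_multigraph_def)
  qed
  obtain u v where uv: "es ! i = (u, v)" by fastforce
  have "es ! Suc i = (v, u)"
    using i nth[of i] nth[of "Suc i"] uv noloop
    by (cases "es ! Suc i") (auto simp: g_def split: if_splits)
  with uv i(1) have "es = take i es @ [(u, v), (v, u)] @ drop (Suc (Suc i)) es"
    by (metis Cons_nth_drop_Suc Suc_lessD append_Cons append_Nil append_take_drop_id)
  then show "\<exists>es1 u v es2. es = es1 @ [(u, v), (v, u)] @ es2" by blast
qed

section \<open>The left graph, by reversal of words\<close>

definition reverse_relations :: "('a list \<times> 'a list) set \<Rightarrow> ('a list \<times> 'a list) set" where
  "reverse_relations R = map_prod rev rev ` R"

text \<open>Reversal turns first letters into last letters and is injective on relations, so cycles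
  of the reversed right graph become cycles of the left graph.\<close>

lemma reverse_relations_backtracking:
  assumes pos: "positive_presentation X R" and acyclic: "acyclic_multigraph (left_graph X R)"
  shows "backtracking (reverse_relations R)"
proof (rule acyclic_right_graph_backtracking)
  show "positive_presentation X (reverse_relations R)"
    using pos unfolding positive_presentation_def reverse_relations_def word_semigroup_def
    by (intro conjI) (simp, clarsimp, drule (1) subsetD, clarsimp)
  have nonempty: "u \<noteq> []" "v \<noteq> []" if "(u, v) \<in> R" for u v
    using pos that by (auto simp: positive_presentation_def word_semigroup_def)
  have "is_cycle (left_graph X R) vs (map (map_prod rev rev) es)"
    if cyc: "is_cycle (right_graph X (reverse_relations R)) vs es" for vs es
  proof -
    have es: "set es \<subseteq> map_prod rev rev ` R"
      using cyc by (auto simp: is_cycle_def right_graph_def reverse_relations_def)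
    have "ends (left_graph X R) (map_prod rev rev e) = ends (right_graph X (reverse_relations R)) e"
      if "e \<in> set es" for e
      using es that nonempty by (force simp: left_graph_def right_graph_def last_rev)
    moreover have "inj (map_prod rev rev :: 'a list \<times> 'a list \<Rightarrow> _)"
      by (intro prod.inj_map inj_on_rev)
    then have "inj_on (map_prod rev rev) (set es)" by (rule inj_on_subset) simp
    moreover have "map_prod rev rev ` set es \<subseteq> R" using es by force
    ultimately show ?thesis
      using cyc unfolding is_cycle_def
      by (simp add: left_graph_def right_graph_def distinct_map)
  qed
  then show "acyclic_multigraph (right_graph X (reverse_relations R))"
    using acyclic by (auto simp: acyclic_multigraph_def)
qed

section \<open>Globalising a partial action of the positive words\<close>

fun path :: "('b \<Rightarrow> ('v \<times> 'v) set) \<Rightarrow> 'b list \<Rightarrow> ('v \<times> 'v) set" where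
  "path A [] = Id"
| "path A (x # w) = A x O path A w"

lemma path_append: "path A (u @ v) = path A u O path A v"
  by (induction u) auto

lemma path_converse: "path (\<lambda>x. (A x)\<inverse>) (rev u) = (path A u)\<inverse>"
  by (induction u) (auto simp: path_append)

text \<open>Equality of the two paths includes equality of their domains, on which
  \<open>derives_end_points\<close> rests.\<close>

definition partial_action :: "('a list \<times> 'a list) set \<Rightarrow> ('a \<Rightarrow> ('v \<times> 'v) set) \<Rightarrow> bool" where
  "partial_action R A \<longleftrightarrow> (\<forall>x. single_valued (A x) \<and> single_valued ((A x)\<inverse>)) \<and>
     (\<forall>u v. (u, v) \<in> R \<longrightarrow> path A u = path A v)"

text \<open>This lets the construction for positive letters be repeated for inverse letters, with
  left and right exchanged.\<close>

lemma partial_action_converse: "partial_action R A \<Longrightarrow> partial_action (reverse_relations R) (\<lambda>x. (A x)\<inverse>)"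
  by (auto simp: partial_action_def reverse_relations_def path_converse)

text \<open>A pair \<open>(\<gamma>, w)\<close> stands for the point reached from \<open>\<gamma>\<close> along the positive word \<open>w\<close>.
  Only the applications of relations are counted.\<close>

inductive derives :: "('a \<Rightarrow> ('v \<times> 'v) set) \<Rightarrow> ('a list \<times> 'a list) set \<Rightarrow>
    nat \<Rightarrow> 'v \<times> 'a list \<Rightarrow> 'v \<times> 'a list \<Rightarrow> bool" for A R where
  refl: "derives A R n s s"
| shift: "derives A R n s (\<gamma>, x # w) \<Longrightarrow> (\<gamma>, \<beta>) \<in> A x \<Longrightarrow> derives A R n s (\<beta>, w)"
| unshift: "derives A R n s (\<beta>, w) \<Longrightarrow> (\<gamma>, \<beta>) \<in> A x \<Longrightarrow> derives A R n s (\<gamma>, x # w)"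
| replace: "derives A R n s (\<gamma>, p @ u @ q) \<Longrightarrow> (u, v) \<in> R \<union> R\<inverse> \<Longrightarrow>
    derives A R (Suc n) s (\<gamma>, p @ v @ q)"

lemma derives_trans: "derives A R n t r \<Longrightarrow> derives A R m s t \<Longrightarrow> derives A R (m + n) s r"
proof (induction rule: derives.induct)
  case (refl n t)
  \<comment> \<open>The index only bounds the number of replacements, since \<open>refl\<close>
    allows any value; the base case is therefore monotonicity of the bound.\<close>
  have "derives A R m s t \<Longrightarrow> m \<le> k \<Longrightarrow> derives A R k s t" for k
  proof (induction arbitrary: k rule: derives.induct)
    case (replace n s \<gamma> p u q v)
    then show ?case using derives.replace[of A R "k - 1" s \<gamma> p u q v] by (cases k) auto
  qed (auto intro: derives.intros)
  with refl show ?case by simp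
qed (auto intro: derives.intros)

lemma derives_mono: "derives A R m s t \<Longrightarrow> m \<le> n \<Longrightarrow> derives A R n s t"
  using derives_trans[OF derives.refl, of A R m s t "n - m"] by simp

lemma derives_sym: "derives A R n s t \<Longrightarrow> derives A R n t s"
proof (induction rule: derives.induct)
  case (shift n s \<gamma> x w \<beta>)
  have "derives A R 0 (\<beta>, w) (\<gamma>, x # w)" by (rule unshift[OF refl]) fact
  from derives_trans[OF shift.IH this] show ?case by simp
next
  case (unshift n s \<beta> w \<gamma> x)
  have "derives A R 0 (\<gamma>, x # w) (\<beta>, w)" by (rule derives.shift[OF refl]) fact
  from derives_trans[OF unshift.IH this] show ?case by simp
next
  case (replace n s \<gamma> p u q v)
  have "derives A R (Suc 0) (\<gamma>, p @ v @ q) (\<gamma>, p @ u @ q)"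
    by (rule derives.replace[OF refl]) (use replace in auto)
  from derives_trans[OF replace.IH this] show ?case by simp
qed (rule refl)

lemma derives_append: "derives A R n s t \<Longrightarrow>
    derives A R n (fst s, snd s @ q) (fst t, snd t @ q)"
proof (induction rule: derives.induct)
  case (replace n s \<gamma> p u q' v)
  then show ?case using derives.replace[of A R n "(fst s, snd s @ q)" \<gamma> p u "q' @ q" v] by simp
qed (auto intro: derives.intros)

lemma derives_path:
  assumes "(\<gamma>, \<beta>) \<in> path A w" shows "derives A R 0 (\<gamma>, w @ q) (\<beta>, q)"
  using assms
proof (induction w arbitrary: \<gamma>)
  case (Cons x w)
  then obtain \<delta> where "(\<gamma>, \<delta>) \<in> A x" "derives A R 0 (\<delta>, w @ q) (\<beta>, q)" by auto
  then show ?case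
    using derives_trans[of A R 0 "(\<delta>, w @ q)" "(\<beta>, q)" 0] shift[OF refl] by fastforce
qed (simp add: refl)

text \<open>A shift along a defined letter keeps the end point because letters are single-valued,
  and a replacement keeps it because both sides act alike. For empty words this says that old points
  are not identified.\<close>

lemma derives_end_points:
  assumes "partial_action R A" "derives A R n s t"
  shows "path A (snd s) `` {fst s} = path A (snd t) `` {fst t}"
  using assms(2)
proof (induction rule: derives.induct)
  case (shift n s \<gamma> x w \<beta>)
  moreover have "A x `` {\<gamma>} = {\<beta>}"
    using assms(1) shift.hyps by (auto simp: partial_action_def single_valued_def)
  ultimately show ?case by (simp add: relcomp_Image)
next
  case (unshift n s \<beta> w \<gamma> x)
  moreover have "A x `` {\<gamma>} = {\<beta>}"
    using assms(1) unshift.hyps by (auto simp: partial_action_def single_valued_def)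
  ultimately show ?case by (simp add: relcomp_Image)
next
  case (replace n s \<gamma> p u q v)
  then have "path A u = path A v" using assms(1) by (auto simp: partial_action_def)
  with replace show ?case by (simp add: path_append)
qed simp

text \<open>A derivation that never consumes the last letter, cut at the applications of relations
  to a suffix; the list records these applications.\<close>

inductive last_derives :: "('a \<Rightarrow> ('v \<times> 'v) set) \<Rightarrow> ('a list \<times> 'a list) set \<Rightarrow> 'v \<times> 'a list \<Rightarrow> 'a \<Rightarrow>
    nat \<Rightarrow> ('a list \<times> 'a list) list \<Rightarrow> 'v \<times> 'a list \<Rightarrow> 'a \<Rightarrow> bool" for A R s x where
  inner: "derives A R n s t \<Longrightarrow> last_derives A R s x n [] t x"
| suffix: "last_derives A R s x m es (\<gamma>, p @ butlast u) (last u) \<Longrightarrow> (u, v) \<in> R \<union> R\<inverse> \<Longrightarrow>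
    derives A R n (\<gamma>, p @ butlast v) t \<Longrightarrow>
    last_derives A R s x (Suc (m + n)) (es @ [(u, v)]) t (last v)"

text \<open>Between two recorded relations the last letter is left alone, so consecutive records
  meet in a common last letter.\<close>

lemma last_derives_walk: "last_derives A R s x n es t y \<Longrightarrow> last_walk R x es y"
  by (induction rule: last_derives.induct) (auto simp: last_walk_append)

text \<open>\<open>t\<close> is the word without its last letter; deriving further there extends the
  final segment and adds no record.\<close>

lemma last_derives_trans:
  assumes "last_derives A R s x m es t y" "derives A R n t r"
  shows "last_derives A R s x (m + n) es r y"
  using assms
proof cases
  case inner
  then show ?thesis using assms(2) by (auto intro: derives_trans last_derives.inner)
next
  case (suffix m' es' \<gamma> p u v n')
  then show ?thesis
    using last_derives.suffix[OF suffix(4,5) derives_trans[OF assms(2) suffix(6)]]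
    by (simp add: add.assoc)
qed

section \<open>Adian's cancellation of the last letter\<close>

context
  fixes A :: "'a \<Rightarrow> ('v \<times> 'v) set" and R :: "('a list \<times> 'a list) set"
  assumes nonempty: "(u, v) \<in> R \<Longrightarrow> u \<noteq> [] \<and> v \<noteq> []"
    and partial_action: "partial_action R A"
begin

lemma suffix_replacement:
  assumes "derives A R m s (\<gamma>, p @ butlast u @ [last u])" "(u, v) \<in> R \<union> R\<inverse>"
    "derives A R n (\<gamma>, p @ butlast v) t"
  shows "derives A R (Suc (m + n)) s (fst t, snd t @ [last v])"
proof -
  have "u \<noteq> []" "v \<noteq> []" using nonempty assms(2) by auto
  then have "derives A R (Suc m) s (\<gamma>, p @ butlast v @ [last v])"
    using derives.replace[of A R m s \<gamma> p u "[]" v] assms by simp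
  with derives_trans[OF derives_append[OF assms(3), of "[last v]"], of "Suc m" s] show ?thesis
    by simp
qed

lemma last_derives_derives: "last_derives A R s x n es t y \<Longrightarrow>
    derives A R n (fst s, snd s @ [x]) (fst t, snd t @ [y])"
proof (induction rule: last_derives.induct)
  case (suffix m es \<gamma> p u v n t)
  then show ?case using suffix_replacement by simp
qed (rule derives_append)

text \<open>End points are invariant under derivation. As \<open>w @ [x]\<close> has none at
  \<open>\<gamma>\<close>, no derivation can consume its last letter.\<close>

lemma derives_last_derives:
  assumes "derives A R n (\<gamma>, w @ [x]) t" "path A (w @ [x]) `` {\<gamma>} = {}"
  shows "\<exists>w' y es. snd t = w' @ [y] \<and> last_derives A R (\<gamma>, w) x n es (fst t, w') y"
  using assms(1)
proof (induction "(\<gamma>, w @ [x])" t rule: derives.induct)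
  case (refl n)
  then show ?case by (auto intro: last_derives.inner derives.refl)
next
  case (shift n \<delta> y w1 \<beta>)
  then obtain w' z es where w': "y # w1 = w' @ [z]"
    and ld: "last_derives A R (\<gamma>, w) x n es (\<delta>, w') z" by auto
  show ?case
  proof (cases w')
    case Nil
    \<comment> \<open>Consuming the only remaining letter would produce an end point.\<close>
    with w' derives_end_points[OF partial_action shift.hyps(1)] assms(2) shift.hyps(3)
    show ?thesis by auto
  next
    case (Cons y' w'')
    with w' have "w1 = w'' @ [z]" "y' = y" by auto
    moreover have "derives A R 0 (\<delta>, w') (\<beta>, w'')"
      using Cons shift.hyps(3) \<open>y' = y\<close> by (auto intro: derives.shift[OF derives.refl])
    ultimately show ?thesis using last_derives_trans[OF ld] by fastforce
  qed
next
  case (unshift n \<beta> w1 \<delta> y)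
  then obtain w' z es where w': "w1 = w' @ [z]"
    and ld: "last_derives A R (\<gamma>, w) x n es (\<beta>, w') z" by auto
  have "derives A R 0 (\<beta>, w') (\<delta>, y # w')"
    by (rule derives.unshift[OF derives.refl]) fact
  from last_derives_trans[OF ld this] w' show ?case by (intro exI[of _ "y # w'"]) auto
next
  case (replace n \<delta> p u q v)
  then obtain w' z es where w': "p @ u @ q = w' @ [z]"
    and ld: "last_derives A R (\<gamma>, w) x n es (\<delta>, w') z" by auto
  have ne: "u \<noteq> []" "v \<noteq> []" using nonempty replace.hyps(3) by auto
  show ?case
  \<comment> \<open>A replacement that reaches the end of the word is recorded; any other takes
    place in front of the last letter.\<close>
  proof (cases q rule: rev_cases)
    case Nil
    with w' ne have "w' = p @ butlast u" "z = last u"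
      by (metis append.right_neutral append_assoc append_butlast_last_id butlast_snoc last_snoc)+
    with ld have "last_derives A R (\<gamma>, w) x (Suc (n + 0)) (es @ [(u, v)]) (\<delta>, p @ butlast v) (last v)"
      using replace.hyps(3) by (intro last_derives.suffix[OF _ _ derives.refl]) auto
    with Nil ne show ?thesis by (intro exI[of _ "p @ butlast v"] exI[of _ "last v"]) auto
  next
    case (snoc q' z')
    with w' have eq: "w' = p @ u @ q'" "z' = z" by auto
    have "derives A R (Suc 0) (\<delta>, w') (\<delta>, p @ v @ q')"
      unfolding eq by (rule derives.replace[OF derives.refl]) fact
    from last_derives_trans[OF ld this] eq snoc show ?thesis
      by (intro exI[of _ "p @ v @ q'"]) auto
  qed
qed

text \<open>Replacing a suffix \<open>u\<close> by \<open>v\<close> and later \<open>v\<close> by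
  \<open>u\<close> can be skipped: between the two, \<open>butlast v\<close> is a common suffix of
  the start and end words and can be cancelled, after which \<open>butlast u\<close> is put in its
  place. This saves two replacements; the later records are then replayed.\<close>

lemma backtrack_shorten:
  assumes cancel: "\<And>k \<gamma> w x \<gamma>' w'. k < n \<Longrightarrow> derives A R k (\<gamma>, w @ [x]) (\<gamma>', w' @ [x]) \<Longrightarrow>
      derives A R k (\<gamma>, w) (\<gamma>', w')"
  shows "last_derives A R s x m (es @ [(u, v), (v, u)] @ fs) t y \<Longrightarrow> m \<le> n \<Longrightarrow>
    \<exists>k<m. derives A R k (fst s, snd s @ [x]) (fst t, snd t @ [y])"
proof (induction fs arbitrary: m t y rule: rev_induct)
  case Nil
  from Nil(1) obtain k1 \<gamma>2 p2 k2 where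
    1: "last_derives A R s x k1 (es @ [(u, v)]) (\<gamma>2, p2 @ butlast v) (last v)"
    and 2: "derives A R k2 (\<gamma>2, p2 @ butlast u) t" "m = Suc (k1 + k2)" "y = last u"
    by (cases rule: last_derives.cases) auto
  from 1 obtain k3 \<gamma>1 p1 k4 where
    3: "last_derives A R s x k3 es (\<gamma>1, p1 @ butlast u) (last u)"
    and 4: "derives A R k4 (\<gamma>1, p1 @ butlast v) (\<gamma>2, p2 @ butlast v)" "k1 = Suc (k3 + k4)"
    by (cases rule: last_derives.cases) auto
  \<comment> \<open>The suffix is cancelled letter by letter; the assumption \<open>cancel\<close>
    applies because \<open>k4 < m\<close> and \<open>m \<le> n\<close>.\<close>
  have "derives A R k4 (\<gamma>1, p1 @ q) (\<gamma>2, p2 @ q) \<Longrightarrow> derives A R k4 (\<gamma>1, p1) (\<gamma>2, p2)" for q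
  proof (induction q rule: rev_induct)
    case (snoc z q)
    then show ?case using cancel[of k4 \<gamma>1 "p1 @ q" z \<gamma>2 "p2 @ q"] 2 4 Nil(2) by auto
  qed simp
  from derives_append[OF this[OF 4(1)], of "butlast u"]
  have "derives A R (k4 + k2) (\<gamma>1, p1 @ butlast u) t" using derives_trans[OF 2(1)] by simp
  from last_derives_derives[OF last_derives_trans[OF 3 this]] 2 4
  show ?case by (intro exI[of _ "k3 + (k4 + k2)"]) auto
next
  case (snoc e fs)
  obtain u' v' where e: "e = (u', v')" by fastforce
  from snoc(2) e obtain k1 \<gamma>1 p k2 where
    1: "last_derives A R s x k1 (es @ [(u, v), (v, u)] @ fs) (\<gamma>1, p @ butlast u') (last u')"
    and 2: "(u', v') \<in> R \<union> R\<inverse>" "derives A R k2 (\<gamma>1, p @ butlast v') t" "m = Suc (k1 + k2)" "y = last v'"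
    by (cases rule: last_derives.cases) (auto simp flip: append_assoc append_Cons)
  from snoc.IH[OF 1] snoc(3) 2(3) obtain k where
    k: "k < k1" "derives A R k (fst s, snd s @ [x]) (\<gamma>1, p @ butlast u' @ [last u'])" by auto
  from suffix_replacement[OF k(2) 2(1,2)] k(1) 2(3,4) show ?case
    by (intro exI[of _ "Suc (k + k2)"]) auto
qed

text \<open>Induction on the number of replacements. If \<open>w @ [x]\<close> is undefined at
  \<open>\<gamma>\<close>, the records form a closed walk at \<open>x\<close>: an empty one leaves a
  derivation of the stems, any other backtracks and gives a shorter derivation.\<close>

lemma derives_cancel:
  assumes "backtracking R"
  shows "derives A R n (\<gamma>, w @ [x]) (\<gamma>', w' @ [x]) \<Longrightarrow> derives A R n (\<gamma>, w) (\<gamma>', w')"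
proof (induction n arbitrary: \<gamma> w x \<gamma>' w' rule: less_induct)
  case (less n)
  show ?case
  proof (cases "path A (w @ [x]) `` {\<gamma>} = {}")
    case True
    then obtain es where es: "last_derives A R (\<gamma>, w) x n es (\<gamma>', w') x"
      using derives_last_derives[OF less.prems] by auto
    show ?thesis
    proof (cases "es = []")
      case True
      with es show ?thesis by (auto elim: last_derives.cases)
    next
      case False
      then obtain es1 u v es2 where "es = es1 @ [(u, v), (v, u)] @ es2"
        using assms last_derives_walk[OF es] unfolding backtracking_def by blast
      with es have "last_derives A R (\<gamma>, w) x n (es1 @ [(u, v), (v, u)] @ es2) (\<gamma>', w') x" by simp
      then have "\<exists>k<n. derives A R k (fst (\<gamma>, w), snd (\<gamma>, w) @ [x]) (fst (\<gamma>', w'), snd (\<gamma>', w') @ [x])"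
        by (rule backtrack_shorten[OF _ _ order_refl, rotated]) (rule less.IH)
      then obtain k where "k < n" "derives A R k (\<gamma>, w @ [x]) (\<gamma>', w' @ [x])" by auto
      with less.IH have "derives A R k (\<gamma>, w) (\<gamma>', w')" by blast
      with \<open>k < n\<close> show ?thesis by (simp add: derives_mono)
    qed
  next
    \<comment> \<open>Both words are defined and lead to the same \<open>\<beta>\<close>.
      Injectivity of \<open>A x\<close> gives a common point \<open>\<delta>\<close> before the last
      letter, to which both stems shift without any replacement.\<close>
    case False
    then obtain \<beta> \<delta> where \<delta>: "(\<gamma>, \<delta>) \<in> path A w" "(\<delta>, \<beta>) \<in> A x" by (auto simp: path_append)
    have "\<beta> \<in> path A (w @ [x]) `` {\<gamma>}" using \<delta> by (auto simp: path_append)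
    also have "path A (w @ [x]) `` {\<gamma>} = path A (w' @ [x]) `` {\<gamma>'}"
      using derives_end_points[OF partial_action less.prems] by simp
    finally have "(\<gamma>', \<beta>) \<in> path A (w' @ [x])" by simp
    then obtain \<delta>' where "(\<gamma>', \<delta>') \<in> path A w'" "(\<delta>', \<beta>) \<in> A x" by (auto simp: path_append)
    moreover from this \<delta> have "\<delta>' = \<delta>"
      using partial_action by (auto simp: partial_action_def single_valued_def)
    ultimately have "derives A R 0 (\<gamma>, w) (\<delta>, [])" "derives A R 0 (\<delta>, []) (\<gamma>', w')"
      using derives_path[of \<gamma> \<delta> A w R "[]"] derives_path[of \<gamma>' \<delta> A w' R "[]"] \<delta>
      by (auto intro: derives_sym)
    with derives_trans have "derives A R 0 (\<gamma>, w) (\<gamma>', w')" by fastforce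
    then show ?thesis by (rule derives_mono) simp
  qed
qed

end

text \<open>Letters are preserved but not reflected: \<open>B\<close> may be defined at image points
  where \<open>A\<close> is not, which is the purpose of an extension.\<close>

definition embeds :: "('v \<Rightarrow> 'u) \<Rightarrow> ('a \<Rightarrow> ('v \<times> 'v) set) \<Rightarrow> ('a \<Rightarrow> ('u \<times> 'u) set) \<Rightarrow> bool" where
  "embeds i A B \<longleftrightarrow> inj i \<and> (\<forall>x \<alpha> \<beta>. (\<alpha>, \<beta>) \<in> A x \<longrightarrow> (i \<alpha>, i \<beta>) \<in> B x)"

lemma embeds_comp: "embeds i A B \<Longrightarrow> embeds j B C \<Longrightarrow> embeds (j \<circ> i) A C"
  by (auto simp: embeds_def inj_compose)

lemma embeds_converse: "embeds i (\<lambda>x. (A x)\<inverse>) B \<longleftrightarrow> embeds i A (\<lambda>x. (B x)\<inverse>)"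
  by (auto simp: embeds_def)

text \<open>The points of \<open>B\<close> are the classes of pairs under \<open>derives\<close>,
  and a letter acts by being appended. The injection \<open>c\<close> names the classes by elements
  of \<open>'u\<close>, so that with \<open>'v = 'u\<close> the construction iterates inside one
  type. Totality is claimed on the image of \<open>i\<close>, since elements of \<open>'u\<close>
  that name no class lie outside the domain.\<close>

lemma globalisation:
  fixes c :: "'v \<times> 'a list \<Rightarrow> 'u"
  assumes c: "inj c" and nonempty: "\<And>u v. (u, v) \<in> R \<Longrightarrow> u \<noteq> [] \<and> v \<noteq> []"
    and backtracking: "backtracking R" and partial_action: "partial_action R (A :: 'a \<Rightarrow> ('v \<times> 'v) set)"
  shows "\<exists>(B :: 'a \<Rightarrow> ('u \<times> 'u) set) i. partial_action R B \<and> embeds i A B \<and> (\<forall>x \<alpha>. i \<alpha> \<in> Domain (B x))"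
proof -
  define eqv where "eqv s t \<longleftrightarrow> (\<exists>n. derives A R n s t)" for s t
  have eqv_refl: "eqv s s" for s by (auto simp: eqv_def intro: derives.refl)
  have eqv_sym: "eqv s t \<Longrightarrow> eqv t s" for s t by (auto simp: eqv_def intro: derives_sym)
  have eqv_trans: "eqv s t \<Longrightarrow> eqv t r \<Longrightarrow> eqv s r" for s t r
    by (auto simp: eqv_def intro: derives_trans)
  \<comment> \<open>The name of the class of \<open>s\<close>: the code of a chosen
    representative.\<close>
  define r where "r s = c (SOME t. eqv s t)" for s
  have r_iff: "r s = r t \<longleftrightarrow> eqv s t" for s t
  proof
    assume "r s = r t"
    then have "(SOME t. eqv s t) = (SOME s. eqv t s)" using c by (auto simp: r_def inj_eq)
    then show "eqv s t" using eqv_refl eqv_sym eqv_trans someI[of "eqv s"] someI[of "eqv t"] by metis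
  next
    assume "eqv s t"
    then have "eqv s = eqv t" using eqv_sym eqv_trans by blast
    then show "r s = r t" by (simp add: r_def)
  qed
  \<comment> \<open>Single-valued because \<open>derives\<close> is stable under appending,
    injective by \<open>derives_cancel\<close>.\<close>
  define B where "B x = {(r (\<gamma>, w), r (\<gamma>, w @ [x])) | \<gamma> w. True}" for x
  define i where "i \<alpha> = r (\<alpha>, [])" for \<alpha>
  have append: "r (\<gamma>, w @ q) = r (\<gamma>', w' @ q)" if "r (\<gamma>, w) = r (\<gamma>', w')" for \<gamma> w \<gamma>' w' q
    using that derives_append[of A R _ "(\<gamma>, w)" "(\<gamma>', w')" q] by (auto simp: r_iff eqv_def)
  have cancel: "r (\<gamma>, w) = r (\<gamma>', w')" if "r (\<gamma>, w @ [x]) = r (\<gamma>', w' @ [x])" for \<gamma> w \<gamma>' w' x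
    using that derives_cancel[OF nonempty partial_action backtracking] by (fastforce simp: r_iff eqv_def)
  \<comment> \<open>The empty word is excluded because its path is the identity on all of
    \<open>'u\<close>, including elements that name no class.\<close>
  have path_B: "path B u = {(r (\<gamma>, w), r (\<gamma>, w @ u)) | \<gamma> w. True}" if "u \<noteq> []" for u
    using that
  proof (induction u rule: list_nonempty_induct)
    case (single x)
    show ?case by (auto simp: B_def)
  next
    case (cons x u)
    show ?case
    proof (intro equalityI subsetI)
      fix e assume "e \<in> path B (x # u)"
      then obtain \<gamma> w \<gamma>' w' where e: "e = (r (\<gamma>, w), r (\<gamma>', w' @ u))"
        and "r (\<gamma>, w @ [x]) = r (\<gamma>', w')" by (auto simp: cons.IH B_def)
      from append[OF this(2), of u] e have "e = (r (\<gamma>, w), r (\<gamma>, w @ x # u))" by simp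
      then show "e \<in> {(r (\<gamma>, w), r (\<gamma>, w @ x # u)) |\<gamma> w. True}" by blast
    next
      fix e assume "e \<in> {(r (\<gamma>, w), r (\<gamma>, w @ x # u)) |\<gamma> w. True}"
      then obtain \<gamma> w where e: "e = (r (\<gamma>, w), r (\<gamma>, (w @ [x]) @ u))" by auto
      have "(r (\<gamma>, w), r (\<gamma>, w @ [x])) \<in> B x" "(r (\<gamma>, w @ [x]), r (\<gamma>, (w @ [x]) @ u)) \<in> path B u"
        by (auto simp: B_def cons.IH simp del: append_assoc)
      with e show "e \<in> path B (x # u)" by auto
    qed
  qed
  have "path B u = path B v" if uv: "(u, v) \<in> R" for u v
  proof -
    have "r (\<gamma>, w @ u) = r (\<gamma>, w @ v)" for \<gamma> w
      using derives.replace[OF derives.refl, of u v R A 0 \<gamma> w "[]"] uv by (auto simp: r_iff eqv_def)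
    with nonempty[OF uv] show ?thesis by (simp add: path_B)
  qed
  moreover have "single_valued (B x)" for x
  proof (rule single_valuedI)
    fix s t t' assume "(s, t) \<in> B x" "(s, t') \<in> B x"
    then obtain \<gamma> w \<gamma>' w' where "s = r (\<gamma>, w)" "t = r (\<gamma>, w @ [x])" "s = r (\<gamma>', w')" "t' = r (\<gamma>', w' @ [x])"
      unfolding B_def by blast
    then show "t = t'" using append[of \<gamma> w \<gamma>' w' "[x]"] by simp
  qed
  moreover have "single_valued ((B x)\<inverse>)" for x
  proof (rule single_valuedI)
    fix s t t' assume "(s, t) \<in> (B x)\<inverse>" "(s, t') \<in> (B x)\<inverse>"
    then obtain \<gamma> w \<gamma>' w' where "t = r (\<gamma>, w)" "s = r (\<gamma>, w @ [x])" "t' = r (\<gamma>', w')" "s = r (\<gamma>', w' @ [x])"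
      unfolding B_def by blast
    then show "t = t'" using cancel[of \<gamma> w x \<gamma>' w'] by simp
  qed
  ultimately have "partial_action R B" by (auto simp: partial_action_def)
  moreover have "embeds i A B"
  proof -
    have "\<alpha> = \<beta>" if "i \<alpha> = i \<beta>" for \<alpha> \<beta>
      using that derives_end_points[OF partial_action, of _ "(\<alpha>, [])" "(\<beta>, [])"]
      by (auto simp: i_def r_iff eqv_def)
    moreover have "(i \<alpha>, i \<beta>) \<in> B x" if "(\<alpha>, \<beta>) \<in> A x" for \<alpha> \<beta> x
    proof -
      have "r (\<alpha>, [x]) = i \<beta>"
        using derives_path[of \<alpha> \<beta> A "[x]" R "[]"] that by (auto simp: r_iff eqv_def i_def)
      moreover have "(r (\<alpha>, []), r (\<alpha>, [] @ [x])) \<in> B x" unfolding B_def by blast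
      ultimately show ?thesis by (simp add: i_def)
    qed
    ultimately show ?thesis by (auto simp: embeds_def inj_def)
  qed
  moreover have "i \<alpha> \<in> Domain (B x)" for x \<alpha>
    unfolding i_def B_def by blast
  ultimately show ?thesis by blast
qed

section \<open>Extending to an action of the group\<close>

fun signed :: "('a \<Rightarrow> ('v \<times> 'v) set) \<Rightarrow> 'a letter \<Rightarrow> ('v \<times> 'v) set" where
  "signed A (Pos x) = A x"
| "signed A (Neg x) = (A x)\<inverse>"

lemma signed_inv_letter: "signed A (inv_letter a) = (signed A a)\<inverse>"
  by (cases a) auto

lemma path_signed_Pos: "path (signed A) (map Pos u) = path A u"
  by (induction u) auto

lemma embeds_signed: "embeds i A B \<Longrightarrow> embeds i (signed A) (signed B)"
  unfolding embeds_def by (auto elim!: signed.elims) (metis converseD converseI letter.exhaust signed.simps)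

lemma embeds_path: "embeds i A B \<Longrightarrow> (\<alpha>, \<beta>) \<in> path A w \<Longrightarrow> (i \<alpha>, i \<beta>) \<in> path B w"
  by (induction w arbitrary: \<alpha>) (auto simp: embeds_def, blast)

lemma signed_single_valued: "partial_action R A \<Longrightarrow> single_valued (signed A a)"
  by (cases a) (auto simp: partial_action_def)

lemma path_single_valued: "(\<And>a. single_valued (A a)) \<Longrightarrow> single_valued (path A w)"
  by (induction w) (auto intro: single_valued_relcomp)

lemma reverse_reverse_relations: "reverse_relations (reverse_relations R) = R"
  by (force simp: reverse_relations_def image_image prod.map_comp)

lemma adian_words_nonempty:
  "adian_presentation X R \<Longrightarrow> (u, v) \<in> R \<Longrightarrow> u \<noteq> [] \<and> v \<noteq> []"
  by (auto simp: adian_presentation_def positive_presentation_def word_semigroup_def)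

text \<open>\<open>B\<close> makes the positive letters total on the image of \<open>i\<close>. Its
  converses satisfy the reversed relations, so a second globalisation makes the inverse letters
  total, and the embedding \<open>j\<close> keeps the positive letters defined on the image of
  \<open>i\<close>.\<close>

lemma extend_by_letters:
  fixes A :: "'a \<Rightarrow> ('u \<times> 'u) set" and c :: "'u \<times> 'a list \<Rightarrow> 'u"
  assumes adian: "adian_presentation X R" and "inj c" and "partial_action R A"
  shows "\<exists>(B :: 'a \<Rightarrow> ('u \<times> 'u) set) i. partial_action R B \<and> embeds i A B \<and>
    (\<forall>a \<alpha>. i \<alpha> \<in> Domain (signed B a))"
proof -
  have nonempty: "u \<noteq> [] \<and> v \<noteq> []" if "(u, v) \<in> R" for u v
    using adian_words_nonempty[OF adian that] .
  have nonempty_rev: "u \<noteq> [] \<and> v \<noteq> []" if "(u, v) \<in> reverse_relations R" for u v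
    using that nonempty by (auto simp: reverse_relations_def)
  have backtracking: "backtracking R" "backtracking (reverse_relations R)"
    using adian acyclic_right_graph_backtracking reverse_relations_backtracking
    by (auto simp: adian_presentation_def)
  obtain B :: "'a \<Rightarrow> ('u \<times> 'u) set" and i where
    B: "partial_action R B" "embeds i A B" "\<And>x \<alpha>. i \<alpha> \<in> Domain (B x)"
    using globalisation[OF \<open>inj c\<close> nonempty backtracking(1) \<open>partial_action R A\<close>] by blast
  obtain C :: "'a \<Rightarrow> ('u \<times> 'u) set" and j where
    C: "partial_action (reverse_relations R) C" "embeds j (\<lambda>x. (B x)\<inverse>) C" "\<And>x \<alpha>. j \<alpha> \<in> Domain (C x)"
    using globalisation[OF \<open>inj c\<close> nonempty_rev backtracking(2) partial_action_converse[OF B(1)]]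
    by blast
  define D where "D = (\<lambda>x. (C x)\<inverse>)"
  have "partial_action R D"
    using partial_action_converse[OF C(1)] by (simp add: D_def reverse_reverse_relations)
  moreover have BD: "embeds j B D" using C(2) by (simp add: D_def embeds_converse)
  moreover have "j (i \<alpha>) \<in> Domain (signed D a)" for a \<alpha>
  proof (cases a)
    case (Pos x)
    obtain \<beta> where "(i \<alpha>, \<beta>) \<in> B x" using B(3) by blast
    with BD have "(j (i \<alpha>), j \<beta>) \<in> D x" by (auto simp: embeds_def)
    with Pos show ?thesis by auto
  next
    case (Neg x)
    then show ?thesis using C(3)[of "i \<alpha>" x] by (auto simp: D_def)
  qed
  ultimately show ?thesis using embeds_comp[OF B(2)] by (auto intro!: exI[of _ D] exI[of _ "j \<circ> i"])
qed

text \<open>Each round pays for one letter: the first letter of a word moves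
  \<open>i \<alpha>\<close> within \<open>B\<close>, and the remaining \<open>n\<close> letters are
  defined by the induction hypothesis for \<open>B\<close>. Stopping at a finite length avoids a
  direct limit.\<close>

lemma extend_by_words:
  fixes A :: "'a \<Rightarrow> ('u \<times> 'u) set" and c :: "'u \<times> 'a list \<Rightarrow> 'u"
  assumes adian: "adian_presentation X R" and c: "inj c" and "partial_action R A"
  shows "\<exists>(B :: 'a \<Rightarrow> ('u \<times> 'u) set) i. partial_action R B \<and> embeds i A B \<and>
    (\<forall>w \<alpha>. length w \<le> n \<longrightarrow> i \<alpha> \<in> Domain (path (signed B) w))"
  using \<open>partial_action R A\<close>
proof (induction n arbitrary: A)
  case 0
  then show ?case by (intro exI[of _ A] exI[of _ id]) (auto simp: embeds_def)
next
  case (Suc n)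
  obtain B :: "'a \<Rightarrow> ('u \<times> 'u) set" and i where
    B: "partial_action R B" "embeds i A B" "\<And>a \<alpha>. i \<alpha> \<in> Domain (signed B a)"
    using extend_by_letters[OF adian c Suc.prems] by blast
  obtain C :: "'a \<Rightarrow> ('u \<times> 'u) set" and j where
    C: "partial_action R C" "embeds j B C"
      "\<And>w \<alpha>. length w \<le> n \<Longrightarrow> j \<alpha> \<in> Domain (path (signed C) w)"
    using Suc.IH[OF B(1)] by blast
  have "j (i \<alpha>) \<in> Domain (path (signed C) w)" if w: "length w \<le> Suc n" for w \<alpha>
  proof (cases w)
    case (Cons a v)
    obtain \<beta> where "(i \<alpha>, \<beta>) \<in> signed B a" using B(3) by blast
    with embeds_signed[OF C(2)] have "(j (i \<alpha>), j \<beta>) \<in> signed C a" by (auto simp: embeds_def)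
    moreover have "j \<beta> \<in> Domain (path (signed C) v)" using C(3) w Cons by simp
    ultimately show ?thesis using Cons by auto
  qed auto
  then have "\<forall>w \<alpha>. length w \<le> Suc n \<longrightarrow> (j \<circ> i) \<alpha> \<in> Domain (path (signed C) w)" by simp
  with C(1) embeds_comp[OF B(2) C(2)] show ?case by blast
qed

section \<open>Equality of words in the group presented by \<open>R\<close>\<close>

inductive group_equal :: "('a list \<times> 'a list) set \<Rightarrow> 'a letter list \<Rightarrow> 'a letter list \<Rightarrow> bool" for R where
  refl: "group_equal R w w"
| sym: "group_equal R w w' \<Longrightarrow> group_equal R w' w"
| trans [trans]: "group_equal R w w' \<Longrightarrow> group_equal R w' w'' \<Longrightarrow> group_equal R w w''"
| cancel: "group_equal R (p @ [a, inv_letter a] @ q) (p @ q)"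
| relation: "(u, v) \<in> R \<Longrightarrow> group_equal R (p @ map Pos u @ q) (p @ map Pos v @ q)"

lemma group_equal_context: "group_equal R w w' \<Longrightarrow> group_equal R (p @ w @ q) (p @ w' @ q)"
proof (induction rule: group_equal.induct)
  case (cancel p' a q')
  then show ?case using group_equal.cancel[of R "p @ p'" a "q' @ q"] by simp
next
  case (relation u v p' q')
  then show ?case using group_equal.relation[of u v R "p @ p'" "q' @ q"] by simp
qed (blast intro: group_equal.intros)+

lemma group_equal_append:
  "group_equal R w w' \<Longrightarrow> group_equal R v v' \<Longrightarrow> group_equal R (w @ v) (w' @ v')"
  using group_equal_context[of R w w' "[]" v] group_equal_context[of R v v' w' "[]"]
  by (auto intro: group_equal.trans)

lemma inv_letter_inv_letter: "inv_letter (inv_letter a) = a"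
  by (cases a) auto

lemma inv_word_inv_word: "inv_word (inv_word w) = w"
  by (simp add: inv_word_def rev_map comp_def inv_letter_inv_letter)

lemma inv_word_Cons: "inv_word (a # w) = inv_word w @ [inv_letter a]"
  by (simp add: inv_word_def)

lemma group_equal_inv_word: "group_equal R (w @ inv_word w) []"
proof (induction w)
  case (Cons a w)
  have "group_equal R ((a # w) @ inv_word (a # w)) ([a] @ [] @ [inv_letter a])"
    using group_equal_context[OF Cons, of "[a]" "[inv_letter a]"] by (simp add: inv_word_Cons)
  also have "group_equal R \<dots> []" using group_equal.cancel[of R "[]" a "[]"] by simp
  finally show ?case .
qed (simp add: inv_word_def group_equal.refl)

lemma group_equal_idem: "group_equal R (z @ w) z \<Longrightarrow> group_equal R w []"
proof -
  assume *: "group_equal R (z @ w) z"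
  have z: "group_equal R (inv_word z @ z) []"
    using group_equal_inv_word[of R "inv_word z"] by (simp add: inv_word_inv_word)
  have "group_equal R w (inv_word z @ z @ w)"
    using group_equal_append[OF group_equal.sym[OF z] group_equal.refl[of R w]] by simp
  also have "group_equal R \<dots> (inv_word z @ z)"
    using group_equal_append[OF group_equal.refl *] by simp
  also note z
  finally show ?thesis .
qed

text \<open>Only cancellation needs a word to be defined: for
  \<open>p @ [a, inv_letter a] @ q\<close> this is the prefix \<open>p @ [a]\<close>. The bound
  \<open>N\<close> depends on the derivation of the equality and not on \<open>A\<close> or
  \<open>\<alpha>\<close>, so an extension can be chosen after it.\<close>

lemma group_equal_end_points:
  assumes "group_equal R w w'"
  shows "\<exists>N. \<forall>A :: 'a \<Rightarrow> ('v \<times> 'v) set. \<forall>\<alpha>. partial_action R A \<longrightarrow>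
    (\<forall>v. length v \<le> N \<longrightarrow> \<alpha> \<in> Domain (path (signed A) v)) \<longrightarrow>
    path (signed A) w `` {\<alpha>} = path (signed A) w' `` {\<alpha>}"
  using assms
proof (induction rule: group_equal.induct)
  case (trans w w' w'')
  then obtain N N' where
    "\<forall>A :: 'a \<Rightarrow> ('v \<times> 'v) set. \<forall>\<alpha>. partial_action R A \<longrightarrow>
      (\<forall>v. length v \<le> N \<longrightarrow> \<alpha> \<in> Domain (path (signed A) v)) \<longrightarrow>
      path (signed A) w `` {\<alpha>} = path (signed A) w' `` {\<alpha>}"
    "\<forall>A :: 'a \<Rightarrow> ('v \<times> 'v) set. \<forall>\<alpha>. partial_action R A \<longrightarrow>
      (\<forall>v. length v \<le> N' \<longrightarrow> \<alpha> \<in> Domain (path (signed A) v)) \<longrightarrow>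
      path (signed A) w' `` {\<alpha>} = path (signed A) w'' `` {\<alpha>}"
    by blast
  then show ?case by (intro exI[of _ "max N N'"]) (simp add: le_max_iff_disj)
next
  case (cancel p a q)
  have "path (signed A) (p @ [a, inv_letter a] @ q) `` {\<alpha>} = path (signed A) (p @ q) `` {\<alpha>}"
    if A: "partial_action R A" and
      dom: "\<forall>v. length v \<le> Suc (length p) \<longrightarrow> \<alpha> \<in> Domain (path (signed A) v)"
    for A :: "'a \<Rightarrow> ('v \<times> 'v) set" and \<alpha>
  proof -
    from dom have "\<alpha> \<in> Domain (path (signed A) (p @ [a]))" by simp
    then obtain \<beta> \<gamma> where \<beta>: "(\<alpha>, \<beta>) \<in> path (signed A) p" and \<gamma>: "(\<beta>, \<gamma>) \<in> signed A a"
      by (auto simp: path_append)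
    have "path (signed A) p `` {\<alpha>} = {\<beta>}"
      using \<beta> path_single_valued[OF signed_single_valued[OF A], of _ p] by (auto simp: single_valued_def)
    moreover have "signed A a `` {\<beta>} = {\<gamma>}" "(signed A a)\<inverse> `` {\<gamma>} = {\<beta>}"
      using \<gamma> signed_single_valued[OF A, of a] signed_single_valued[OF A, of "inv_letter a"]
      by (auto simp: single_valued_def signed_inv_letter)
    ultimately show ?thesis by (simp add: path_append relcomp_Image signed_inv_letter)
  qed
  then show ?case by blast
next
  case (relation u v p q)
  then show ?case by (auto simp: path_append path_signed_Pos partial_action_def)
qed (auto simp: eq_commute)

text \<open>The empty path is the identity on the whole type and not the image of a path, hence the
  assumption on the words of \<open>R\<close>.\<close>

lemma partial_action_image:
  assumes "partial_action R A" "inj i" and nonempty: "\<And>u v. (u, v) \<in> R \<Longrightarrow> u \<noteq> [] \<and> v \<noteq> []"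
  shows "partial_action R (\<lambda>x. map_prod i i ` A x)"
proof -
  have path: "path (\<lambda>x. map_prod i i ` A x) u = map_prod i i ` path A u" if "u \<noteq> []" for u
    using that
  proof (induction u rule: list_nonempty_induct)
    case (cons x u)
    then show ?case using \<open>inj i\<close> by (force simp: inj_eq)
  qed simp
  have "path (\<lambda>x. map_prod i i ` A x) u = path (\<lambda>x. map_prod i i ` A x) v" if "(u, v) \<in> R" for u v
    using that nonempty[OF that] assms(1) by (simp add: path partial_action_def)
  moreover have "single_valued (map_prod i i ` A x)" "single_valued ((map_prod i i ` A x)\<inverse>)" for x
    using assms(1,2) unfolding partial_action_def single_valued_def by (auto simp: inj_eq)
  ultimately show ?thesis by (auto simp: partial_action_def)
qed

text \<open>In an extension where all words of length up to \<open>N\<close> are defined on the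
  image, \<open>w\<close> acts there like the empty word and fixes the image of
  \<open>\<alpha>\<close>. Injectivity of the embedding gives the claim.\<close>

lemma trivial_word_closes:
  fixes A :: "'a \<Rightarrow> ('v \<times> 'v) set"
  assumes adian: "adian_presentation X R" and A: "partial_action R A" and w: "group_equal R w []"
    and path: "(\<alpha>, \<beta>) \<in> path (signed A) w"
  shows "\<alpha> = \<beta>"
proof -
  \<comment> \<open>A type that contains the old points as singleton lists and is closed under
    pairing with a word, by consing the word. The iterated extensions all live in it.\<close>
  define i :: "'v \<Rightarrow> ('v + 'a list) list" where "i = (\<lambda>\<gamma>. [Inl \<gamma>])"
  define c :: "('v + 'a list) list \<times> 'a list \<Rightarrow> ('v + 'a list) list" where "c = (\<lambda>(s, w). Inr w # s)"
  have "inj i" "inj c" by (auto simp: i_def c_def inj_def)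
  define A' where "A' = (\<lambda>x. map_prod i i ` A x)"
  have A': "partial_action R A'"
    unfolding A'_def using A \<open>inj i\<close> adian_words_nonempty[OF adian] by (rule partial_action_image)
  have "embeds i A A'" using \<open>inj i\<close> by (auto simp: A'_def embeds_def)
  obtain N where N: "\<And>(B :: 'a \<Rightarrow> (('v + 'a list) list \<times> ('v + 'a list) list) set) \<gamma>.
      partial_action R B \<Longrightarrow> (\<And>v. length v \<le> N \<Longrightarrow> \<gamma> \<in> Domain (path (signed B) v)) \<Longrightarrow>
      path (signed B) w `` {\<gamma>} = path (signed B) [] `` {\<gamma>}"
    using group_equal_end_points[OF w] by metis
  obtain B :: "'a \<Rightarrow> (('v + 'a list) list \<times> ('v + 'a list) list) set" and j where
    B: "partial_action R B" "embeds j A' B"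
      "\<And>v \<gamma>. length v \<le> N \<Longrightarrow> j \<gamma> \<in> Domain (path (signed B) v)"
    using extend_by_words[OF adian \<open>inj c\<close> A', of N] by blast
  have ji: "embeds (j \<circ> i) A B" using embeds_comp[OF \<open>embeds i A A'\<close> B(2)] .
  have "((j \<circ> i) \<alpha>, (j \<circ> i) \<beta>) \<in> path (signed B) w"
    using embeds_path[OF embeds_signed[OF ji] path] .
  then have "(j \<circ> i) \<beta> \<in> path (signed B) w `` {(j \<circ> i) \<alpha>}" by (rule ImageI) simp
  also have "path (signed B) w `` {(j \<circ> i) \<alpha>} = {(j \<circ> i) \<alpha>}"
    using N[OF B(1)] B(3) by simp
  finally have "(j \<circ> i) \<alpha> = (j \<circ> i) \<beta>" by simp
  moreover have "inj (j \<circ> i)" using ji by (simp add: embeds_def)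
  ultimately show ?thesis by (simp only: inj_eq)
qed

section \<open>Inverse semigroups\<close>

context inverse_semigroup
begin

abbreviation (input) i where "i \<equiv> sinv S"

lemma sinv:
  assumes "a \<in> carrier S"
  shows sinv_closed: "i a \<in> carrier S" and mult_sinv_mult: "a \<star> i a \<star> a = a"
    and sinv_mult_sinv: "i a \<star> a \<star> i a = i a"
  using theI'[OF unique_inverse[OF assms]] unfolding sinv_def by auto

lemma sinv_eqI:
  "\<lbrakk>a \<in> carrier S; b \<in> carrier S; a \<star> b \<star> a = a; b \<star> a \<star> b = b\<rbrakk> \<Longrightarrow> i a = b"
  using unique_inverse[of a] sinv[of a] by blast

lemma sinv_sinv: "a \<in> carrier S \<Longrightarrow> i (i a) = a"
  by (rule sinv_eqI) (simp_all add: sinv)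

lemma idempotents_carrier: "e \<in> idempotents S \<Longrightarrow> e \<in> carrier S"
  and idempotents_idem: "e \<in> idempotents S \<Longrightarrow> e \<star> e = e"
  by (auto simp: idempotents_def)

lemma idem_mult_left: "e \<in> idempotents S \<Longrightarrow> a \<in> carrier S \<Longrightarrow> e \<star> (e \<star> a) = e \<star> a"
  by (metis assoc idempotents_carrier idempotents_idem)

lemma sinv_idempotent: "e \<in> idempotents S \<Longrightarrow> i e = e"
  by (rule sinv_eqI) (auto simp: idempotents_def)

text \<open>For the inverse \<open>x\<close> of \<open>e \<star> f\<close>, the element
  \<open>f \<star> (x \<star> e)\<close> is an inverse too, so it equals \<open>x\<close>, which
  makes \<open>x\<close> idempotent. An idempotent is its own inverse, so \<open>x\<close> is
  \<open>e \<star> f\<close>.\<close>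

lemma mult_idempotent:
  assumes e: "e \<in> idempotents S" and f: "f \<in> idempotents S"
  shows "e \<star> f \<in> idempotents S"
proof -
  define x where "x = i (e \<star> f)"
  have [simp]: "e \<in> carrier S" "f \<in> carrier S" using e f by (auto simp: idempotents_carrier)
  have [simp]: "x \<in> carrier S" by (simp add: x_def sinv_closed closed)
  have 1: "e \<star> (f \<star> (x \<star> (e \<star> f))) = e \<star> f" and 2: "x \<star> (e \<star> (f \<star> x)) = x"
    using mult_sinv_mult[of "e \<star> f"] sinv_mult_sinv[of "e \<star> f"]
    by (simp_all add: closed assoc flip: x_def)
  have 3: "x \<star> (e \<star> (f \<star> (x \<star> y))) = x \<star> y" if "y \<in> carrier S" for y
    using that arg_cong[OF 2, of "\<lambda>z. z \<star> y"] by (simp add: closed assoc)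
  have "x = f \<star> (x \<star> e)"
    unfolding x_def
    by (rule sinv_eqI)
      (simp_all add: closed assoc idem_mult_left e f 1 3 flip: x_def)
  then have "x \<star> x = f \<star> (x \<star> e)"
    using 3[of e] by (metis \<open>e \<in> carrier S\<close> \<open>f \<in> carrier S\<close> \<open>x \<in> carrier S\<close> assoc closed)
  with \<open>x = f \<star> (x \<star> e)\<close> have "x \<in> idempotents S" by (simp add: idempotents_def)
  moreover have "i x = e \<star> f" by (simp add: x_def sinv_sinv closed)
  ultimately show ?thesis using sinv_idempotent by metis
qed

text \<open>\<open>f \<star> e\<close> is an inverse of the idempotent \<open>e \<star> f\<close>,
  which is its own inverse.\<close>

lemma idempotents_commute:
  assumes e: "e \<in> idempotents S" and f: "f \<in> idempotents S"
  shows "e \<star> f = f \<star> e"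
proof -
  have [simp]: "e \<in> carrier S" "f \<in> carrier S" using e f by (auto simp: idempotents_carrier)
  have ef: "e \<star> (f \<star> (e \<star> f)) = e \<star> f" and fe: "f \<star> (e \<star> (f \<star> e)) = f \<star> e"
    using idempotents_idem[OF mult_idempotent[OF e f]] idempotents_idem[OF mult_idempotent[OF f e]]
    by (simp_all add: closed assoc)
  have "i (e \<star> f) = f \<star> e"
    by (rule sinv_eqI) (simp_all add: closed assoc idem_mult_left e f ef fe)
  with sinv_idempotent[OF mult_idempotent[OF e f]] show ?thesis by simp
qed

lemma mult_sinv_idempotent: "a \<in> carrier S \<Longrightarrow> a \<star> i a \<in> idempotents S"
  and sinv_mult_idempotent: "a \<in> carrier S \<Longrightarrow> i a \<star> a \<in> idempotents S"
  by (simp_all add: idempotents_def closed sinv_closed mult_sinv_mult sinv_mult_sinv flip: assoc)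

lemma mult_sinv_mult_left:
  assumes "a \<in> carrier S" "b \<in> carrier S"
  shows "a \<star> (i a \<star> (a \<star> b)) = a \<star> b" "i a \<star> (a \<star> (i a \<star> b)) = i a \<star> b"
  using assms mult_sinv_mult[of a] sinv_mult_sinv[of a] by (metis assoc closed sinv_closed)+

lemma idempotents_commute_left:
  assumes "e \<in> idempotents S" "f \<in> idempotents S" "a \<in> carrier S"
  shows "e \<star> (f \<star> a) = f \<star> (e \<star> a)"
  using assms idempotents_commute by (metis assoc idempotents_carrier)

lemma sinv_mult:
  assumes [simp]: "a \<in> carrier S" "b \<in> carrier S"
  shows "i (a \<star> b) = i b \<star> i a"
proof (rule sinv_eqI)
  note [simp] = closed sinv_closed
  have comm: "(b \<star> i b) \<star> ((i a \<star> a) \<star> c) = (i a \<star> a) \<star> ((b \<star> i b) \<star> c)" if "c \<in> carrier S" for c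
    using that by (intro idempotents_commute_left mult_sinv_idempotent sinv_mult_idempotent) auto
  show "a \<star> b \<star> (i b \<star> i a) \<star> (a \<star> b) = a \<star> b"
    using comm[of b] by (simp add: assoc mult_sinv_mult_left)
      (metis assms assoc closed mult_sinv_mult sinv_closed)
  show "i b \<star> i a \<star> (a \<star> b) \<star> (i b \<star> i a) = i b \<star> i a"
    using comm[of "i a"] by (simp add: assoc mult_sinv_mult_left)
      (metis assms assoc closed sinv_mult_sinv sinv_closed)
qed (simp_all add: closed sinv_closed)

text \<open>A common lower bound \<open>c\<close> gives the idempotent \<open>c \<star> i c\<close>,
  which sends both elements to \<open>c\<close>. Conversely \<open>e \<star> d\<close> lies below
  \<open>d\<close> for every idempotent \<open>e\<close>.\<close>

lemma min_group_congruence_iff: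
  "(a, b) \<in> min_group_congruence S \<longleftrightarrow>
     a \<in> carrier S \<and> b \<in> carrier S \<and> (\<exists>e \<in> idempotents S. e \<star> a = e \<star> b)"
proof safe
  assume "(a, b) \<in> min_group_congruence S"
  then obtain c where ab: "a \<in> carrier S" "b \<in> carrier S" and c: "c \<in> carrier S"
    "c \<star> i c \<star> a = c" "c \<star> i c \<star> b = c"
    by (auto simp: min_group_congruence_def natural_le_def)
  then have "c \<star> i c \<star> a = c \<star> i c \<star> b" by simp
  with c(1) ab show "a \<in> carrier S" "b \<in> carrier S" "\<exists>e \<in> idempotents S. e \<star> a = e \<star> b"
    using mult_sinv_idempotent by blast+
next
  fix e assume [simp]: "a \<in> carrier S" "b \<in> carrier S"
    and e: "e \<in> idempotents S" and eq: "e \<star> a = e \<star> b"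
  have "natural_le S (e \<star> d) d" if [simp]: "d \<in> carrier S" for d
  proof -
    note [simp] = idempotents_carrier[OF e] closed sinv_closed
    have "e \<star> d \<star> i (e \<star> d) \<star> d = e \<star> ((d \<star> i d) \<star> (e \<star> d))"
      by (simp add: sinv_mult sinv_idempotent[OF e] assoc)
    also have "\<dots> = e \<star> (e \<star> ((d \<star> i d) \<star> d))"
      using e by (simp only: idempotents_commute_left[OF mult_sinv_idempotent e] that)
    also have "\<dots> = e \<star> d" using e by (simp add: mult_sinv_mult idem_mult_left)
    finally show ?thesis by (simp add: natural_le_def)
  qed
  from this[of a] this[of b] eq have "natural_le S (e \<star> a) a" "natural_le S (e \<star> a) b" by simp_all
  with e show "(a, b) \<in> min_group_congruence S"
    by (auto simp: min_group_congruence_def closed idempotents_carrier)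
qed

lemma min_group_congruence_congruence: "congruence_on S (min_group_congruence S)"
proof -
  have "(a, c) \<in> min_group_congruence S"
    if ab: "(a, b) \<in> min_group_congruence S" and bc: "(b, c) \<in> min_group_congruence S" for a b c
  proof -
    obtain e f where e: "e \<in> idempotents S" "e \<star> a = e \<star> b" and f: "f \<in> idempotents S" "f \<star> b = f \<star> c"
      and [simp]: "a \<in> carrier S" "b \<in> carrier S" "c \<in> carrier S"
      using ab bc by (auto simp: min_group_congruence_iff)
    note [simp] = idempotents_carrier[OF e(1)] idempotents_carrier[OF f(1)]
    have "e \<star> f \<star> a = f \<star> (e \<star> a)"
      using e f by (simp add: assoc idempotents_commute_left[of e f])
    also have "\<dots> = e \<star> f \<star> c"
      using e f by (simp add: assoc idempotents_commute_left[of f e])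
    finally show ?thesis using mult_idempotent[OF e(1) f(1)] by (auto simp: min_group_congruence_iff)
  qed
  moreover have "(a, a) \<in> min_group_congruence S" if "a \<in> carrier S" for a
    using that mult_sinv_idempotent by (auto simp: min_group_congruence_iff)
  ultimately have equiv: "equiv (carrier S) (min_group_congruence S)"
    by (intro equivI refl_onI symI transI)
       (auto simp: min_group_congruence_iff, metis+)
  have "(c \<star> a, c \<star> b) \<in> min_group_congruence S \<and> (a \<star> c, b \<star> c) \<in> min_group_congruence S"
    if ab: "(a, b) \<in> min_group_congruence S" and [simp]: "c \<in> carrier S" for a b c
  proof -
    obtain e where e: "e \<in> idempotents S" "e \<star> a = e \<star> b"
      and [simp]: "a \<in> carrier S" "b \<in> carrier S"
      using ab by (auto simp: min_group_congruence_iff)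
    note [simp] = idempotents_carrier[OF e(1)] closed sinv_closed
    \<comment> \<open>The conjugate idempotent, which moves \<open>e\<close> across a left factor
      \<open>c\<close>.\<close>
    define g where "g = c \<star> (e \<star> i c)"
    have g: "g \<star> (c \<star> d) = c \<star> (e \<star> d)" if "d \<in> carrier S" for d
    proof -
      have "g \<star> (c \<star> d) = c \<star> (e \<star> ((i c \<star> c) \<star> d))" using that by (simp add: g_def assoc)
      also have "\<dots> = c \<star> ((i c \<star> c) \<star> (e \<star> d))"
        using that e by (simp only: idempotents_commute_left[OF e(1) sinv_mult_idempotent] \<open>c \<in> carrier S\<close>)
      also have "\<dots> = c \<star> (e \<star> d)" using that by (simp add: assoc mult_sinv_mult_left)
      finally show ?thesis .
    qed
    have "g \<star> g = g"
      using g[of "e \<star> i c"] e(1) by (simp add: g_def idem_mult_left)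
    moreover have "g \<in> carrier S" by (simp add: g_def)
    ultimately have "g \<in> idempotents S" "g \<star> (c \<star> a) = g \<star> (c \<star> b)"
      using g e by (simp_all add: idempotents_def)
    moreover have "e \<star> (a \<star> c) = e \<star> (b \<star> c)" using e(2) by (simp flip: assoc)
    ultimately show ?thesis using e(1) by (auto simp: min_group_congruence_iff)
  qed
  with equiv show ?thesis by (auto simp: congruence_on_def)
qed

end

section \<open>Quotients and a criterion for E-unitarity\<close>

lemma quotient_op:
  assumes r: "congruence_on S r" and "a \<in> carrier S" "b \<in> carrier S"
  shows "r `` {a} \<star>\<^bsub>quotient_magma S r\<^esub> r `` {b} = r `` {a \<star>\<^bsub>S\<^esub> b}"
proof -
  have equiv: "equiv (carrier S) r" using r by (simp add: congruence_on_def)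
  have "r `` {a' \<star>\<^bsub>S\<^esub> b'} = r `` {a \<star>\<^bsub>S\<^esub> b}" if "(a, a') \<in> r" "(b, b') \<in> r" for a' b'
  proof -
    have "b \<in> carrier S" "a' \<in> carrier S" using that equiv by (auto simp: equiv_def refl_on_def)
    with that r have "(a \<star>\<^bsub>S\<^esub> b, a' \<star>\<^bsub>S\<^esub> b) \<in> r" "(a' \<star>\<^bsub>S\<^esub> b, a' \<star>\<^bsub>S\<^esub> b') \<in> r"
      by (auto simp: congruence_on_def)
    with equiv show ?thesis by (metis equiv_class_eq)
  qed
  then have "(\<Union>a'\<in>r `` {a}. \<Union>b'\<in>r `` {b}. r `` {a' \<star>\<^bsub>S\<^esub> b'}) =
      (\<Union>a'\<in>r `` {a}. \<Union>b'\<in>r `` {b}. r `` {a \<star>\<^bsub>S\<^esub> b})"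
    by (intro SUP_cong HOL.refl) simp
  moreover have "(a, a) \<in> r" "(b, b) \<in> r" using assms(2,3) equiv by (auto simp: equiv_def refl_on_def)
  then have "r `` {a} \<noteq> {}" "r `` {b} \<noteq> {}" by blast+
  ultimately show ?thesis by (simp add: quotient_magma_def)
qed

text \<open>All idempotents lie in one class of the minimum group congruence, and this class is the
  identity. The assumption \<open>pure\<close> says that it contains nothing else.\<close>

lemma (in inverse_semigroup) E_unitary_criterion:
  assumes "carrier S \<noteq> {}"
    and pure: "\<And>e a. e \<in> idempotents S \<Longrightarrow> a \<in> carrier S \<Longrightarrow> e \<star> a = e \<Longrightarrow> a \<in> idempotents S"
  shows "E_unitary S"
proof -
  let ?\<sigma> = "min_group_congruence S"
  have equiv: "equiv (carrier S) ?\<sigma>"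
    using min_group_congruence_congruence by (simp add: congruence_on_def)
  obtain f where f: "f \<in> idempotents S" using assms(1) mult_sinv_idempotent by blast
  note [simp] = idempotents_carrier[OF f] closed sinv_closed
  have identity: "is_identity (max_group_image S) (?\<sigma> `` {f})"
    unfolding is_identity_def
  proof (intro conjI ballI)
    show "?\<sigma> `` {f} \<in> carrier (max_group_image S)"
      by (simp add: max_group_image_def quotient_magma_def quotientI)
    fix K assume "K \<in> carrier (max_group_image S)"
    then obtain a where [simp]: "a \<in> carrier S" and K: "K = ?\<sigma> `` {a}"
      by (auto simp: max_group_image_def quotient_magma_def elim: quotientE)
    have "(f \<star> a, a) \<in> ?\<sigma>"
      using f idem_mult_left[OF f] by (auto simp: min_group_congruence_iff intro!: bexI[of _ f])
    moreover have "(a \<star> f, a) \<in> ?\<sigma>"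
    proof -
      \<comment> \<open>Conjugating \<open>f\<close> by \<open>a\<close> moves it to the left of
        \<open>a\<close>, so that \<open>a \<star> f\<close> and \<open>a\<close> agree after
        multiplication by the idempotent \<open>g\<close>.\<close>
      define g where "g = a \<star> (f \<star> i a)"
      have "g \<star> a = a \<star> (f \<star> ((i a \<star> a) \<star> (i a \<star> a)))"
        by (simp add: g_def assoc mult_sinv_mult_left)
      also have "\<dots> = a \<star> ((i a \<star> a) \<star> (f \<star> (i a \<star> a)))"
        by (simp only: idempotents_commute_left[OF f sinv_mult_idempotent] \<open>a \<in> carrier S\<close> closed sinv_closed)
      also have "f \<star> (i a \<star> a) = (i a \<star> a) \<star> f"
        by (simp only: idempotents_commute[OF f sinv_mult_idempotent] \<open>a \<in> carrier S\<close>)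
      also have "a \<star> ((i a \<star> a) \<star> ((i a \<star> a) \<star> f)) = a \<star> f"
        by (simp add: assoc mult_sinv_mult_left)
      finally have g: "g \<star> a = a \<star> f" .
      have gg: "g \<star> g = g \<star> (a \<star> (f \<star> i a))" by (simp add: g_def)
      also have "\<dots> = (g \<star> a) \<star> (f \<star> i a)" by (simp add: assoc g_def)
      also have "\<dots> = g" using f by (simp add: g) (simp add: g_def assoc idem_mult_left)
      finally have "g \<in> idempotents S" by (simp add: idempotents_def g_def)
      moreover have "g \<star> (a \<star> f) = (g \<star> a) \<star> f" by (simp add: assoc g_def)
      then have "g \<star> (a \<star> f) = g \<star> a" using f by (simp add: g assoc idempotents_idem)
      ultimately show ?thesis by (auto simp: min_group_congruence_iff)
    qed
    ultimately show "?\<sigma> `` {f} \<star>\<^bsub>max_group_image S\<^esub> K = K" "K \<star>\<^bsub>max_group_image S\<^esub> ?\<sigma> `` {f} = K"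
      unfolding K max_group_image_def
      by (simp_all add: quotient_op[OF min_group_congruence_congruence] equiv_class_eq[OF equiv])
  qed
  have "{a \<in> carrier S. ?\<sigma> `` {a} = ?\<sigma> `` {f}} = idempotents S"
  proof (intro subset_antisym subsetI)
    fix a assume a: "a \<in> idempotents S"
    have "a \<star> f \<star> a = a \<star> f \<star> f"
      using a f by (metis assoc idempotents_carrier idempotents_commute idempotents_idem)
    with a mult_idempotent[OF a f] have "(a, f) \<in> ?\<sigma>"
      by (auto simp: min_group_congruence_iff idempotents_carrier)
    then show "a \<in> {a \<in> carrier S. ?\<sigma> `` {a} = ?\<sigma> `` {f}}"
      using equiv_class_eq[OF equiv] idempotents_carrier[OF a] by simp
  next
    fix a assume "a \<in> {a \<in> carrier S. ?\<sigma> `` {a} = ?\<sigma> `` {f}}"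
    then have [simp]: "a \<in> carrier S" and "?\<sigma> `` {a} = ?\<sigma> `` {f}" by auto
    then have "(a, f) \<in> ?\<sigma>" using eq_equiv_class[OF _ equiv] by simp
    then obtain e where e: "e \<in> idempotents S" "e \<star> a = e \<star> f" by (auto simp: min_group_congruence_iff)
    note [simp] = idempotents_carrier[OF e(1)]
    \<comment> \<open>The product of both idempotents absorbs \<open>a\<close> on the right, as
      \<open>pure\<close> requires.\<close>
    have "f \<star> e \<star> a = f \<star> e \<star> f" using e by (simp add: assoc)
    also have "\<dots> = f \<star> e" using e f by (metis idempotents_commute idem_mult_left assoc idempotents_carrier)
    finally show "a \<in> idempotents S" using pure[of "f \<star> e" a] mult_idempotent[OF f e(1)] by simp
  qed
  with identity inverse_semigroup_axioms show ?thesis unfolding E_unitary_def by blast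
qed

text \<open>The Vagner-Preston representation by right translations.\<close>

context inverse_semigroup
begin

definition translation :: "'a \<Rightarrow> ('a \<times> 'a) set" where
  "translation a = {(s, s \<star> a) | s. s \<in> carrier S \<and> s \<star> (a \<star> i a) = s}"

lemma single_valued_translation: "single_valued (translation a)"
  by (auto simp: translation_def single_valued_def)

text \<open>On the domain, fixed by \<open>a \<star> i a\<close>, multiplication by \<open>a\<close>
  is undone by \<open>i a\<close>. One inclusion suffices, taken for both \<open>a\<close> and
  \<open>i a\<close>.\<close>

lemma translation_sinv:
  assumes [simp]: "a \<in> carrier S" shows "translation (i a) = (translation a)\<inverse>"
proof -
  have "(translation b)\<inverse> \<subseteq> translation (i b)" if [simp]: "b \<in> carrier S" for b
  proof clarify
    fix s t assume "(t, s) \<in> translation b"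
    then have t: "s = t \<star> b" "t \<in> carrier S" "t \<star> (b \<star> i b) = t" by (auto simp: translation_def)
    then have "s \<star> i b = t" "s \<in> carrier S" "s \<star> (i b \<star> i (i b)) = s"
      by (simp_all add: assoc closed sinv_closed sinv_sinv mult_sinv_mult[of b, unfolded assoc[OF that sinv_closed[OF that] that]])
    then show "(s, t) \<in> translation (i b)" by (auto simp: translation_def)
  qed
  from this[of a] this[of "i a"] show ?thesis by (auto simp: sinv_closed sinv_sinv)
qed

text \<open>The content is the equality of domains. If \<open>s\<close> is fixed by
  \<open>a \<star> b \<star> i (a \<star> b)\<close>, commuting the idempotents
  \<open>b \<star> i b\<close> and \<open>i a \<star> a\<close> shows that
  \<open>s \<star> a\<close> is fixed by \<open>b \<star> i b\<close>.\<close>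

lemma translation_mult:
  assumes [simp]: "a \<in> carrier S" "b \<in> carrier S"
  shows "translation (a \<star> b) = translation a O translation b"
proof -
  note [simp] = closed sinv_closed
  have "s \<star> (a \<star> b \<star> i (a \<star> b)) = s \<longleftrightarrow> s \<star> (a \<star> i a) = s \<and> s \<star> a \<star> (b \<star> i b) = s \<star> a"
    (is "?l \<longleftrightarrow> ?r") if [simp]: "s \<in> carrier S" for s
  proof
    have abs: "s \<star> (a \<star> b \<star> i (a \<star> b)) = s \<star> a \<star> (b \<star> i b) \<star> i a"
      by (simp add: sinv_mult assoc)
    {
      assume ?r
      then show ?l by (simp add: abs) (simp add: assoc)
    }
    assume ?l
    then have s: "s \<star> (a \<star> (b \<star> (i b \<star> i a))) = s" by (simp add: sinv_mult assoc)
    have "s \<star> (a \<star> i a) = s \<star> (a \<star> (b \<star> (i b \<star> i a))) \<star> (a \<star> i a)" by (simp only: s)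
    also have "\<dots> = s \<star> (a \<star> (b \<star> (i b \<star> i a)))"
      by (simp add: assoc mult_sinv_mult_left sinv_mult_sinv[of a, unfolded assoc[OF sinv_closed[OF assms(1)] assms(1) sinv_closed[OF assms(1)]]])
    finally have 1: "s \<star> (a \<star> i a) = s" by (simp only: s)
    have "s \<star> a = s \<star> (a \<star> (b \<star> (i b \<star> i a))) \<star> a" by (simp only: s)
    also have "\<dots> = s \<star> (a \<star> ((b \<star> i b) \<star> (i a \<star> a)))" by (simp add: assoc)
    also have "(b \<star> i b) \<star> (i a \<star> a) = (i a \<star> a) \<star> (b \<star> i b)"
      by (intro idempotents_commute mult_sinv_idempotent sinv_mult_idempotent) simp_all
    also have "s \<star> (a \<star> ((i a \<star> a) \<star> (b \<star> i b))) = s \<star> a \<star> (b \<star> i b)"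
      by (simp add: assoc mult_sinv_mult_left)
    finally show ?r using 1 by simp
  qed
  then show ?thesis by (auto simp: translation_def assoc)
qed

end

text \<open>Two inverses \<open>b\<close> and \<open>c\<close> of \<open>a\<close> agree: commuting
  \<open>a c\<close> with \<open>a b\<close> turns \<open>b\<close> into \<open>b a c\<close>, and
  commuting \<open>b a\<close> with \<open>c a\<close> turns this into \<open>c\<close>.\<close>

lemma inverse_semigroupI:
  assumes closed: "\<And>a b. a \<in> carrier S \<Longrightarrow> b \<in> carrier S \<Longrightarrow> a \<star>\<^bsub>S\<^esub> b \<in> carrier S"
    and assoc: "\<And>a b c. a \<in> carrier S \<Longrightarrow> b \<in> carrier S \<Longrightarrow> c \<in> carrier S \<Longrightarrow>
      a \<star>\<^bsub>S\<^esub> b \<star>\<^bsub>S\<^esub> c = a \<star>\<^bsub>S\<^esub> (b \<star>\<^bsub>S\<^esub> c)"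
    and regular: "\<And>a. a \<in> carrier S \<Longrightarrow>
      \<exists>b \<in> carrier S. a \<star>\<^bsub>S\<^esub> b \<star>\<^bsub>S\<^esub> a = a \<and> b \<star>\<^bsub>S\<^esub> a \<star>\<^bsub>S\<^esub> b = b"
    and commute: "\<And>e f. e \<in> idempotents S \<Longrightarrow> f \<in> idempotents S \<Longrightarrow> e \<star>\<^bsub>S\<^esub> f = f \<star>\<^bsub>S\<^esub> e"
  shows "inverse_semigroup S"
proof
  fix a assume [simp]: "a \<in> carrier S"
  note [simp] = closed
  have "b = c" if [simp]: "b \<in> carrier S" "c \<in> carrier S"
    and b: "a \<star>\<^bsub>S\<^esub> b \<star>\<^bsub>S\<^esub> a = a" "b \<star>\<^bsub>S\<^esub> a \<star>\<^bsub>S\<^esub> b = b"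
    and c: "a \<star>\<^bsub>S\<^esub> c \<star>\<^bsub>S\<^esub> a = a" "c \<star>\<^bsub>S\<^esub> a \<star>\<^bsub>S\<^esub> c = c" for b c
  proof -
    have idem: "a \<star>\<^bsub>S\<^esub> b \<in> idempotents S" "b \<star>\<^bsub>S\<^esub> a \<in> idempotents S"
      "a \<star>\<^bsub>S\<^esub> c \<in> idempotents S" "c \<star>\<^bsub>S\<^esub> a \<in> idempotents S"
      using b c by (simp_all add: idempotents_def flip: assoc)
    have "b = b \<star>\<^bsub>S\<^esub> (a \<star>\<^bsub>S\<^esub> c \<star>\<^bsub>S\<^esub> a) \<star>\<^bsub>S\<^esub> b" by (simp add: b c)
    also have "\<dots> = b \<star>\<^bsub>S\<^esub> ((a \<star>\<^bsub>S\<^esub> c) \<star>\<^bsub>S\<^esub> (a \<star>\<^bsub>S\<^esub> b))" by (simp add: assoc)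
    also have "\<dots> = b \<star>\<^bsub>S\<^esub> ((a \<star>\<^bsub>S\<^esub> b) \<star>\<^bsub>S\<^esub> (a \<star>\<^bsub>S\<^esub> c))" by (simp only: commute[OF idem(3,1)])
    also have "\<dots> = (b \<star>\<^bsub>S\<^esub> a \<star>\<^bsub>S\<^esub> b) \<star>\<^bsub>S\<^esub> a \<star>\<^bsub>S\<^esub> c" by (simp add: assoc)
    also have "\<dots> = (b \<star>\<^bsub>S\<^esub> a) \<star>\<^bsub>S\<^esub> (c \<star>\<^bsub>S\<^esub> a \<star>\<^bsub>S\<^esub> c)" by (simp add: b c assoc)
    also have "\<dots> = ((b \<star>\<^bsub>S\<^esub> a) \<star>\<^bsub>S\<^esub> (c \<star>\<^bsub>S\<^esub> a)) \<star>\<^bsub>S\<^esub> c" by (simp add: assoc)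
    also have "\<dots> = ((c \<star>\<^bsub>S\<^esub> a) \<star>\<^bsub>S\<^esub> (b \<star>\<^bsub>S\<^esub> a)) \<star>\<^bsub>S\<^esub> c" by (simp only: commute[OF idem(2,4)])
    also have "\<dots> = c \<star>\<^bsub>S\<^esub> (a \<star>\<^bsub>S\<^esub> b \<star>\<^bsub>S\<^esub> a) \<star>\<^bsub>S\<^esub> c" by (simp add: assoc)
    also have "\<dots> = c" by (simp add: b c)
    finally show ?thesis .
  qed
  moreover obtain b where "b \<in> carrier S" "a \<star>\<^bsub>S\<^esub> b \<star>\<^bsub>S\<^esub> a = a" "b \<star>\<^bsub>S\<^esub> a \<star>\<^bsub>S\<^esub> b = b"
    using regular[of a] by auto
  ultimately show "\<exists>!b. b \<in> carrier S \<and> a \<star>\<^bsub>S\<^esub> b \<star>\<^bsub>S\<^esub> a = a \<and> b \<star>\<^bsub>S\<^esub> a \<star>\<^bsub>S\<^esub> b = b"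
    by (intro ex1I[of _ b]) blast+
qed (use closed assoc in auto)

section \<open>The inverse semigroup of a presentation\<close>

lemma congruence_generated_subset:
  "congruence_on S r \<Longrightarrow> Q \<subseteq> r \<Longrightarrow> congruence_generated S Q \<subseteq> r"
  unfolding congruence_generated_def by blast

lemma subset_congruence_generated: "Q \<subseteq> congruence_generated S Q"
  unfolding congruence_generated_def by blast

lemma congruence_on_congruence_generated:
  assumes closed: "\<And>a b. a \<in> carrier S \<Longrightarrow> b \<in> carrier S \<Longrightarrow> a \<star>\<^bsub>S\<^esub> b \<in> carrier S"
    and Q: "Q \<subseteq> carrier S \<times> carrier S"
  shows "congruence_on S (congruence_generated S Q)"
proof -
  let ?C = "{r. congruence_on S r \<and> Q \<subseteq> r}"
  \<comment> \<open>The full relation belongs to the family, so the intersection stays inside the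
    carrier.\<close>
  have "congruence_on S (carrier S \<times> carrier S)"
    using closed by (auto simp: congruence_on_def intro!: equivI refl_onI symI transI)
  then have full: "carrier S \<times> carrier S \<in> ?C" using Q by blast
  have C: "equiv (carrier S) r"
    "(a, b) \<in> r \<Longrightarrow> c \<in> carrier S \<Longrightarrow> (c \<star>\<^bsub>S\<^esub> a, c \<star>\<^bsub>S\<^esub> b) \<in> r \<and> (a \<star>\<^bsub>S\<^esub> c, b \<star>\<^bsub>S\<^esub> c) \<in> r"
    if "r \<in> ?C" for r a b c
    using that by (auto simp: congruence_on_def)
  have "equiv (carrier S) (\<Inter> ?C)"
  proof (rule equivI)
    show "\<Inter> ?C \<subseteq> carrier S \<times> carrier S" using full by (rule Inter_lower)
    show "refl_on (carrier S) (\<Inter> ?C)"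
      using C(1) by (intro refl_onI InterI) (auto simp: equiv_def refl_on_def)
    show "sym (\<Inter> ?C)"
      using C(1) by (intro symI InterI) (meson InterD equivE symD)
    show "trans (\<Inter> ?C)"
      using C(1) by (intro transI InterI) (meson InterD equivE transD)
  qed
  then show ?thesis
    using C(2) unfolding congruence_generated_def congruence_on_def[of S "\<Inter> ?C"] by blast
qed

lemma quotient_carrier: "carrier (quotient_magma S r) = (\<lambda>a. r `` {a}) ` carrier S"
  by (auto simp: quotient_magma_def quotient_def)

definition defining_congruence ::
    "'a set \<Rightarrow> ('a list \<times> 'a list) set \<Rightarrow> ('a letter list set \<times> 'a letter list set) set" where
  "defining_congruence X R = congruence_generated (free_inverse_semigroup X)
     {(positive_element X u, positive_element X v) | u v. (u, v) \<in> R}"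

text \<open>The value of a signed word: a class of classes, because \<open>Inv\<close> is a quotient
  of a quotient.\<close>

definition element :: "'a set \<Rightarrow> ('a list \<times> 'a list) set \<Rightarrow> 'a letter list \<Rightarrow> 'a letter list set set" where
  "element X R w = defining_congruence X R `` {vagner X `` {w}}"

lemma Inv_quotient: "Inv X R = quotient_magma (free_inverse_semigroup X) (defining_congruence X R)"
  by (simp add: Inv_def defining_congruence_def)

lemma signed_words_iff: "w \<in> carrier (signed_words X) \<longleftrightarrow> w \<noteq> [] \<and> set w \<subseteq> Pos ` X \<union> Neg ` X"
  by (simp add: signed_words_def word_semigroup_def)

lemma signed_words_op: "u \<star>\<^bsub>signed_words X\<^esub> v = u @ v"
  by (simp add: signed_words_def word_semigroup_def)

lemma inv_word_signed_words: "w \<in> carrier (signed_words X) \<Longrightarrow> inv_word w \<in> carrier (signed_words X)"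
proof -
  assume "w \<in> carrier (signed_words X)"
  moreover have "inv_letter ` (Pos ` X \<union> Neg ` X) \<subseteq> Pos ` X \<union> Neg ` X" by auto
  ultimately show "inv_word w \<in> carrier (signed_words X)" by (simp add: signed_words_iff inv_word_def) blast
qed

lemma append_signed_words: "u \<in> carrier (signed_words X) \<Longrightarrow> v \<in> carrier (signed_words X) \<Longrightarrow> u @ v \<in> carrier (signed_words X)"
  by (auto simp: signed_words_iff)

lemma vagner_congruence: "congruence_on (signed_words X) (vagner X)"
  unfolding vagner_def
  by (rule congruence_on_congruence_generated) (auto simp: signed_words_op append_signed_words inv_word_signed_words)

lemma vagner_mult:
  "u \<in> carrier (signed_words X) \<Longrightarrow> v \<in> carrier (signed_words X) \<Longrightarrow>
    vagner X `` {u} \<star>\<^bsub>free_inverse_semigroup X\<^esub> vagner X `` {v} = vagner X `` {u @ v}"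
  using quotient_op[OF vagner_congruence] by (simp add: free_inverse_semigroup_def signed_words_op)

lemma free_inverse_carrier: "carrier (free_inverse_semigroup X) = (\<lambda>w. vagner X `` {w}) ` carrier (signed_words X)"
  by (simp add: free_inverse_semigroup_def quotient_carrier)

context
  fixes X :: "'a set" and R :: "('a list \<times> 'a list) set"
  assumes positive: "positive_presentation X R"
begin

private abbreviation (input) W where "W \<equiv> carrier (signed_words X)"
private abbreviation (input) S where "S \<equiv> Inv X R"
private abbreviation (input) \<pi> where "\<pi> \<equiv> element X R"

lemma relation_signed_words:
  assumes "(u, v) \<in> R" shows "map Pos u \<in> W" "map Pos v \<in> W"
  using assms positive unfolding positive_presentation_def word_semigroup_def signed_words_iff by auto

lemma defining_congruence_congruence:
  "congruence_on (free_inverse_semigroup X) (defining_congruence X R)"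
  unfolding defining_congruence_def
  by (rule congruence_on_congruence_generated)
     (auto simp: free_inverse_carrier vagner_mult append_signed_words positive_element_def relation_signed_words)

lemma element_mult: "u \<in> W \<Longrightarrow> v \<in> W \<Longrightarrow> \<pi> u \<star>\<^bsub>S\<^esub> \<pi> v = \<pi> (u @ v)"
  using quotient_op[OF defining_congruence_congruence, of "vagner X `` {u}" "vagner X `` {v}"]
  by (simp add: Inv_quotient element_def vagner_mult free_inverse_carrier)

lemma carrier_Inv: "carrier S = \<pi> ` W"
  by (simp add: Inv_quotient quotient_carrier free_inverse_carrier image_image element_def)

lemma element_vagner: "(u, v) \<in> vagner X \<Longrightarrow> \<pi> u = \<pi> v"
  using equiv_class_eq[of W "vagner X" u v] vagner_congruence[of X]
  by (simp add: element_def congruence_on_def)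

lemma element_regular: "u \<in> W \<Longrightarrow> \<pi> (u @ inv_word u @ u) = \<pi> u"
  by (rule element_vagner) (auto simp: vagner_def intro!: subsetD[OF subset_congruence_generated])

lemma element_commute: "u \<in> W \<Longrightarrow> v \<in> W \<Longrightarrow>
    \<pi> (u @ inv_word u @ v @ inv_word v) = \<pi> (v @ inv_word v @ u @ inv_word u)"
  by (rule element_vagner) (auto simp: vagner_def intro!: subsetD[OF subset_congruence_generated])

lemma element_relation:
  assumes "(u, v) \<in> R" shows "\<pi> (map Pos u) = \<pi> (map Pos v)"
proof -
  have "(positive_element X u, positive_element X v) \<in> defining_congruence X R"
    unfolding defining_congruence_def
    by (rule subsetD[OF subset_congruence_generated]) (use assms in blast)
  moreover have "equiv (carrier (free_inverse_semigroup X)) (defining_congruence X R)"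
    using defining_congruence_congruence by (simp add: congruence_on_def)
  ultimately have "defining_congruence X R `` {positive_element X u} =
      defining_congruence X R `` {positive_element X v}"
    by (rule equiv_class_eq[rotated])
  then show ?thesis by (simp add: element_def positive_element_def)
qed

text \<open>The inverse semigroup maps onto its image in the group: equality in the group is a
  congruence that contains the Vagner pairs and the relations. The argument runs twice, with
  \<open>\<theta>\<close> on words and with the induced \<open>\<theta>'\<close> on Vagner
  classes.\<close>

lemma element_eq_group_equal:
  assumes "u \<in> W" "v \<in> W" "\<pi> u = \<pi> v"
  shows "group_equal R u v"
proof -
  define \<theta> where "\<theta> = {(u, v). u \<in> W \<and> v \<in> W \<and> group_equal R u v}"
  have theta: "congruence_on (signed_words X) \<theta>"
    unfolding congruence_on_def \<theta>_def
    by (intro conjI equivI refl_onI symI transI)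
       (auto simp: signed_words_op append_signed_words
         intro: group_equal.intros group_equal_append[OF group_equal.refl] group_equal_append[OF _ group_equal.refl])
  have uu: "group_equal R (u @ inv_word u @ v) v" for u v
    using group_equal_append[OF group_equal_inv_word[of R u] group_equal.refl[of R v]] by simp
  have "group_equal R (u @ inv_word u @ v @ inv_word v) (v @ inv_word v @ u @ inv_word u)" for u v
  proof -
    have "group_equal R (u @ inv_word u @ v @ inv_word v) []" for u v
      using uu group_equal_inv_word by (rule group_equal.trans)
    then show ?thesis by (metis group_equal.sym group_equal.trans)
  qed
  then have vagner: "vagner X \<subseteq> \<theta>"
    unfolding vagner_def using uu
    by (intro congruence_generated_subset[OF theta]) (auto simp: \<theta>_def append_signed_words inv_word_signed_words)
  have equiv: "equiv W (vagner X)" "equiv W \<theta>"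
    using vagner_congruence theta by (auto simp: congruence_on_def)
  have class_theta: "(u, v) \<in> \<theta>" if "vagner X `` {u} = vagner X `` {v}" "v \<in> W" for u v
    using eq_equiv_class[OF that(1) equiv(1) that(2)] vagner by blast
  define \<theta>' where "\<theta>' = {(vagner X `` {u}, vagner X `` {v}) | u v. (u, v) \<in> \<theta>}"
  \<comment> \<open>Membership in \<open>\<theta>'\<close> holds for all representatives because
    \<open>\<theta>\<close> contains the Vagner congruence.\<close>
  have theta'D: "(u, v) \<in> \<theta>" if uv: "(vagner X `` {u}, vagner X `` {v}) \<in> \<theta>'" "u \<in> W" "v \<in> W" for u v
  proof -
    obtain u' v' where eq: "vagner X `` {u'} = vagner X `` {u}" "vagner X `` {v} = vagner X `` {v'}"
      and uv': "(u', v') \<in> \<theta>" using uv(1) by (auto simp: \<theta>'_def)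
    have W': "v' \<in> W" "u' \<in> W" using uv' by (auto simp: \<theta>_def)
    have "(u, u') \<in> \<theta>" "(v', v) \<in> \<theta>" using class_theta[OF eq(1)[symmetric]] class_theta[OF eq(2)[symmetric]] uv W' by auto
    with uv' equiv(2) show ?thesis by (meson equivE transD)
  qed
  have "congruence_on (free_inverse_semigroup X) \<theta>'"
    unfolding congruence_on_def
  proof (intro conjI equivI)
    show "\<theta>' \<subseteq> carrier (free_inverse_semigroup X) \<times> carrier (free_inverse_semigroup X)"
      by (auto simp: \<theta>'_def \<theta>_def free_inverse_carrier)
    show "refl_on (carrier (free_inverse_semigroup X)) \<theta>'"
      by (rule refl_onI) (auto simp: \<theta>'_def \<theta>_def free_inverse_carrier intro: group_equal.refl)
    show "sym \<theta>'"
      by (rule symI) (auto simp: \<theta>'_def \<theta>_def intro: group_equal.sym)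
    show "trans \<theta>'"
    proof (rule transI)
      fix a b c assume "(a, b) \<in> \<theta>'" "(b, c) \<in> \<theta>'"
      then obtain u v v' w where eq: "a = vagner X `` {u}" "b = vagner X `` {v}"
        "b = vagner X `` {v'}" "c = vagner X `` {w}" and "(u, v) \<in> \<theta>" "(v', w) \<in> \<theta>"
        unfolding \<theta>'_def by blast
      moreover have "(v, v') \<in> \<theta>"
        using class_theta[of v v'] eq \<open>(v', w) \<in> \<theta>\<close> by (auto simp: \<theta>_def)
      ultimately have "(u, w) \<in> \<theta>" using equiv(2) by (meson equivE transD)
      with eq show "(a, c) \<in> \<theta>'" unfolding \<theta>'_def by blast
    qed
    show "\<forall>(a, b) \<in> \<theta>'. \<forall>c \<in> carrier (free_inverse_semigroup X).
      (c \<star>\<^bsub>free_inverse_semigroup X\<^esub> a, c \<star>\<^bsub>free_inverse_semigroup X\<^esub> b) \<in> \<theta>' \<and>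
      (a \<star>\<^bsub>free_inverse_semigroup X\<^esub> c, b \<star>\<^bsub>free_inverse_semigroup X\<^esub> c) \<in> \<theta>'"
    proof clarify
      fix a b c assume "(a, b) \<in> \<theta>'" "c \<in> carrier (free_inverse_semigroup X)"
      then obtain u v w where eq: "a = vagner X `` {u}" "b = vagner X `` {v}" "c = vagner X `` {w}"
        and uv: "(u, v) \<in> \<theta>" "w \<in> W"
        by (auto simp: \<theta>'_def free_inverse_carrier)
      then have "(w @ u, w @ v) \<in> \<theta>" "(u @ w, v @ w) \<in> \<theta>"
        using theta by (auto simp: congruence_on_def signed_words_op)
      moreover have "u \<in> W" "v \<in> W" using uv by (auto simp: \<theta>_def)
      ultimately show "(c \<star>\<^bsub>free_inverse_semigroup X\<^esub> a, c \<star>\<^bsub>free_inverse_semigroup X\<^esub> b) \<in> \<theta>' \<and>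
        (a \<star>\<^bsub>free_inverse_semigroup X\<^esub> c, b \<star>\<^bsub>free_inverse_semigroup X\<^esub> c) \<in> \<theta>'"
        unfolding eq using uv by (simp add: vagner_mult) (auto simp: \<theta>'_def)
    qed
  qed
  moreover have "(positive_element X u, positive_element X v) \<in> \<theta>'" if "(u, v) \<in> R" for u v
    using that relation_signed_words[OF that] group_equal.relation[of u v R "[]" "[]"]
    unfolding positive_element_def \<theta>'_def \<theta>_def by auto
  ultimately have sub: "defining_congruence X R \<subseteq> \<theta>'"
    unfolding defining_congruence_def by (intro congruence_generated_subset) auto
  have "equiv (carrier (free_inverse_semigroup X)) (defining_congruence X R)"
    using defining_congruence_congruence by (simp add: congruence_on_def)
  then have "(vagner X `` {u}, vagner X `` {v}) \<in> defining_congruence X R"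
    using assms by (intro eq_equiv_class) (auto simp: free_inverse_carrier element_def)
  with sub have "(u, v) \<in> \<theta>" using theta'D assms by blast
  then show ?thesis by (simp add: \<theta>_def)
qed

text \<open>The Vagner pairs commute only idempotents of the form
  \<open>\<pi> (u @ inv_word u)\<close>; the main point is that every idempotent has this
  form.\<close>

lemma inverse_semigroup_Inv: "inverse_semigroup S"
proof (rule inverse_semigroupI)
  have idem: "\<exists>u \<in> W. e = \<pi> (u @ inv_word u)" if "e \<in> idempotents S" for e
  proof -
    from that obtain u where u: "u \<in> W" "e = \<pi> u" and uu: "\<pi> (u @ u) = \<pi> u"
      by (auto simp: idempotents_def carrier_Inv element_mult)
    define v where "v = inv_word u"
    have v: "v \<in> W" using u by (simp add: v_def inv_word_signed_words)
    note [simp] = u(1) v append_signed_words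
    have eq_context: "\<pi> (p @ a @ q) = \<pi> (p @ b @ q)"
      if "\<pi> a = \<pi> b" "a \<in> W" "b \<in> W" "p \<in> W" "q \<in> W" for a b p q
      using that by (metis append_signed_words element_mult)
    have eq_left: "\<pi> (p @ a) = \<pi> (p @ b)" and eq_right: "\<pi> (a @ p) = \<pi> (b @ p)"
      if "\<pi> a = \<pi> b" "a \<in> W" "b \<in> W" "p \<in> W" for a b p
      using that by (metis element_mult)+
    have uvu: "\<pi> (u @ v @ u) = \<pi> u" using element_regular[of u] by (simp add: v_def)
    have vuv: "\<pi> (v @ u @ v) = \<pi> v"
      using element_regular[OF v] by (simp add: v_def inv_word_inv_word)
    \<comment> \<open>In the quotient \<open>v = v u v = v u u v = u v v u\<close>. Multiplying by
      the idempotent \<open>u\<close> on either side fixes the last product, so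
      \<open>u v = v = v u\<close>, and then \<open>u = u v u = u v\<close>.\<close>
    have "\<pi> v = \<pi> (v @ u @ u @ v)"
      using vuv eq_context[OF uu, of v v] by simp
    also have "\<dots> = \<pi> (u @ v @ v @ u)"
      using element_commute[OF v u(1)] by (simp add: v_def inv_word_inv_word)
    finally have v_eq: "\<pi> v = \<pi> (u @ v @ v @ u)" .
    have "\<pi> (u @ v) = \<pi> (u @ u @ v @ v @ u)" using eq_left[OF v_eq, of u] by simp
    also have "\<dots> = \<pi> (u @ v @ v @ u)" using eq_right[OF uu, of "v @ v @ u"] by simp
    finally have uv: "\<pi> (u @ v) = \<pi> v" using v_eq by simp
    have "\<pi> (v @ u) = \<pi> (u @ v @ v @ u @ u)" using eq_right[OF v_eq, of u] by simp
    also have "\<dots> = \<pi> (u @ v @ v @ u)" using eq_left[OF uu, of "u @ v @ v"] by simp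
    finally have vu: "\<pi> (v @ u) = \<pi> v" using v_eq by simp
    have "\<pi> u = \<pi> (u @ v)" using uvu eq_right[OF uv, of u] vu uv by simp
    with u show ?thesis by (auto simp: v_def)
  qed
  fix e f assume "e \<in> idempotents S" "f \<in> idempotents S"
  with idem obtain u v where "u \<in> W" "v \<in> W" "e = \<pi> (u @ inv_word u)" "f = \<pi> (v @ inv_word v)"
    by metis
  then show "e \<star>\<^bsub>S\<^esub> f = f \<star>\<^bsub>S\<^esub> e"
    using element_commute[of u v] by (simp add: element_mult append_signed_words inv_word_signed_words)
next
  fix a assume "a \<in> carrier S"
  then obtain u where u: "u \<in> W" "a = \<pi> u" by (auto simp: carrier_Inv)
  then show "\<exists>b \<in> carrier S. a \<star>\<^bsub>S\<^esub> b \<star>\<^bsub>S\<^esub> a = a \<and> b \<star>\<^bsub>S\<^esub> a \<star>\<^bsub>S\<^esub> b = b"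
    using element_regular[of u] element_regular[of "inv_word u"]
    by (intro bexI[of _ "\<pi> (inv_word u)"])
       (simp_all add: carrier_Inv element_mult append_signed_words inv_word_signed_words inv_word_inv_word)
qed (auto simp: carrier_Inv element_mult append_signed_words)

lemma sinv_element: "w \<in> W \<Longrightarrow> sinv S (\<pi> w) = \<pi> (inv_word w)"
  using element_regular[of w] element_regular[of "inv_word w"]
  by (intro inverse_semigroup.sinv_eqI[OF inverse_semigroup_Inv])
     (simp_all add: carrier_Inv element_mult append_signed_words inv_word_signed_words inv_word_inv_word)

section \<open>The partial action of the letters on the inverse semigroup\<close>

interpretation Inv: inverse_semigroup S
  by (rule inverse_semigroup_Inv)

text \<open>A \<open>partial_action\<close> has a value at every element of the letter type; outside
  \<open>X\<close> it is the empty partial injection.\<close>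

definition generator_translation where
  "generator_translation x = (if x \<in> X then Inv.translation (\<pi> [Pos x]) else {})"

lemma signed_translation:
  "a \<in> Pos ` X \<union> Neg ` X \<Longrightarrow> signed generator_translation a = Inv.translation (\<pi> [a])"
proof -
  have "\<pi> [Pos x] \<in> carrier S" "sinv S (\<pi> [Pos x]) = \<pi> [Neg x]" if "x \<in> X" for x
    using that by (simp_all add: carrier_Inv sinv_element signed_words_iff inv_word_def)
  then show "a \<in> Pos ` X \<union> Neg ` X \<Longrightarrow> signed generator_translation a = Inv.translation (\<pi> [a])"
    using Inv.translation_sinv by (fastforce simp: generator_translation_def)
qed

lemma path_translation:
  assumes "w \<in> W" shows "path (signed generator_translation) w = Inv.translation (\<pi> w)"
proof -
  have "w \<noteq> []" "set w \<subseteq> Pos ` X \<union> Neg ` X" using assms by (auto simp: signed_words_iff)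
  then show ?thesis
  proof (induction w rule: list_nonempty_induct)
    case (cons a w)
    then have "[a] \<in> W" "w \<in> W" by (auto simp: signed_words_iff)
    then show ?case
      using Inv.translation_mult[of "\<pi> [a]" "\<pi> w"] cons
      by (simp add: carrier_Inv element_mult signed_translation)
  qed (simp add: signed_translation)
qed

lemma partial_action_generator_translation: "partial_action R generator_translation"
proof -
  have "path generator_translation u = path generator_translation v" if "(u, v) \<in> R" for u v
    using path_translation[OF relation_signed_words(1)[OF that]] path_translation[OF relation_signed_words(2)[OF that]]
    by (simp add: path_signed_Pos element_relation[OF that])
  moreover have "single_valued ((Inv.translation (\<pi> [Pos x]))\<inverse>)" if "x \<in> X" for x
  proof -
    have "\<pi> [Pos x] \<in> carrier S" using that by (auto simp: carrier_Inv signed_words_iff)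
    with Inv.translation_sinv show ?thesis
      by (metis Inv.single_valued_translation)
  qed
  ultimately show ?thesis
    by (simp add: partial_action_def generator_translation_def Inv.single_valued_translation)
qed

end

theorem theorem2p1:
  fixes X :: "'a set" and R :: "('a list \<times> 'a list) set"
  assumes "adian_presentation X R"
  shows "E_unitary (Inv X R)"
proof -
  have positive: "positive_presentation X R" using assms by (simp add: adian_presentation_def)
  interpret Inv: inverse_semigroup "Inv X R" by (rule inverse_semigroup_Inv[OF positive])
  note [simp] = carrier_Inv[OF positive] element_mult[OF positive]
  show ?thesis
  proof (rule Inv.E_unitary_criterion)
    obtain x where "x \<in> X" using positive by (auto simp: positive_presentation_def)
    then have "[Pos x] \<in> carrier (signed_words X)" by (simp add: signed_words_iff)
    then show "carrier (Inv X R) \<noteq> {}" by auto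
  next
    fix e a assume e: "e \<in> idempotents (Inv X R)" and a: "a \<in> carrier (Inv X R)"
      and ea: "e \<star>\<^bsub>Inv X R\<^esub> a = e"
    obtain z w where zw: "z \<in> carrier (signed_words X)" "w \<in> carrier (signed_words X)"
      "e = element X R z" "a = element X R w"
      using a Inv.idempotents_carrier[OF e] by auto
    with ea have "element X R (z @ w) = element X R z" by simp
    \<comment> \<open>Equality in \<open>S\<close> persists in the group, where \<open>z\<close> can
      be cancelled.\<close>
    with zw have "group_equal R (z @ w) z"
      using element_eq_group_equal[OF positive] append_signed_words by metis
    then have w: "group_equal R w []" by (rule group_equal_idem)
    let ?b = "a \<star>\<^bsub>Inv X R\<^esub> sinv (Inv X R) a"
    \<comment> \<open>\<open>?b\<close> is idempotent, hence in the domain of translation by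
      \<open>a\<close>, which moves it to \<open>a \<star> i a \<star> a\<close>, that is, to
      \<open>a\<close>.\<close>
    have "(?b, ?b \<star>\<^bsub>Inv X R\<^esub> a) \<in> Inv.translation a"
      using Inv.idempotents_idem[OF Inv.mult_sinv_idempotent[OF a]]
        Inv.idempotents_carrier[OF Inv.mult_sinv_idempotent[OF a]]
      unfolding Inv.translation_def by blast
    then have "(?b, a) \<in> path (signed (generator_translation X R)) w"
      using path_translation[OF positive zw(2)] zw(4) Inv.mult_sinv_mult[OF a] by simp
    then have "?b = a"
      by (rule trivial_word_closes[OF assms partial_action_generator_translation[OF positive] w])
    then show "a \<in> idempotents (Inv X R)" using Inv.mult_sinv_idempotent[OF a] by simp
  qed
qed

end
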